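(* Let $\Omega$ be a class of $C^*$-algebras which have the property SP. Then $A$ has the property SP for any simple unital $C^*$-algebra $A\in\mathrm{gTA}\Omega$.
   Context: A $C^*$-algebra $A$ has the property SP if every non-zero hereditary $C^*$-subalgebra of $A$ contains a non-zero projection. Notation. For an element $x$ and a subset $B$ of a $C^*$-algebra $A$, $x\in_{\varepsilon} B$ means that there is $b\in B$ with $\|x-b\|<\varepsilon$. For a positive element $a$ and $\varepsilon>0$, $(a-\varepsilon)_+$ is the element $f(a)$ obtained by functional calculus with $f(t)=\max(0,t-\varepsilon)$. $M_\infty(A)$ is the algebraic inductive limit (union) of the matrix algebras $M_n(A)$ under upper left-hand corner embeddings; for positive $a,b\in M_\infty(A)$, $a\precsim b$ ($a$ is Cuntz subequivalent to $b$) means that there is a sequence $(v_n)$ in $M_\infty(A)$ with $\|v_nbv_n^*-a\|\to 0$. Definition of $\mathrm{gTA}\Omega$. Let $\Omega$ be a class of $C^*$-algebras. A simple $C^*$-algebra $A$ belongs to $\mathrm{gTA}\Omega$ if for any $\varepsilon>0$, every finite set $F\subseteq A$, and every pair of positive elements $a,y\in A$ with $a\neq 0$, there exist a $C^*$-subalgebra $B$ of $A$ with $B\in\Omega$ and a positive element $g\in B$ with $\|g\|\le 1$ such that: (1) $\|xg-gx\|<\varepsilon$ for all $x\in F$; (2) $gx\in_\varepsilon B$ and $xg\in_\varepsilon B$ for all $x\in F$; (3) $(y^2-ygy-\varepsilon)_+\precsim a$; and (4) $\|gag\|\ge\|a\|-\varepsilon$. *)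

theory Defs
  imports "HOL-Analysis.Analysis"
begin

section \<open>C*-algebras on an explicit carrier\<close>

record 'a cstar_struct =
  carrier :: "'a set"
  czero :: 'a  ("\<zero>\<index>")
  cadd :: "'a \<Rightarrow> 'a \<Rightarrow> 'a"  (infixl "\<oplus>\<index>" 65)
  cmult :: "'a \<Rightarrow> 'a \<Rightarrow> 'a"  (infixl "\<otimes>\<index>" 70)
  cscale :: "complex \<Rightarrow> 'a \<Rightarrow> 'a"  (infixr "\<odot>\<index>" 75)
  cstar :: "'a \<Rightarrow> 'a"  ("_\<^sup>\<star>\<index>" [1000] 999)
  cnorm :: "'a \<Rightarrow> real"  ("\<parallel>_\<parallel>\<index>")

definition cminus :: "('a, 'm) cstar_struct_scheme \<Rightarrow> 'a \<Rightarrow> 'a \<Rightarrow> 'a"  (infixl "\<ominus>\<index>" 65)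
  where "x \<ominus>\<^bsub>A\<^esub> y = x \<oplus>\<^bsub>A\<^esub> (-1) \<odot>\<^bsub>A\<^esub> y"

locale cstar_algebra =
  fixes A :: "('a, 'm) cstar_struct_scheme" (structure)
  assumes zero_closed: "\<zero> \<in> carrier A"
    and add_closed: "\<lbrakk>x \<in> carrier A; y \<in> carrier A\<rbrakk> \<Longrightarrow> x \<oplus> y \<in> carrier A"
    and mult_closed: "\<lbrakk>x \<in> carrier A; y \<in> carrier A\<rbrakk> \<Longrightarrow> x \<otimes> y \<in> carrier A"
    and scale_closed: "x \<in> carrier A \<Longrightarrow> c \<odot> x \<in> carrier A"
    and star_closed: "x \<in> carrier A \<Longrightarrow> x\<^sup>\<star> \<in> carrier A"
    and add_assoc: "\<lbrakk>x \<in> carrier A; y \<in> carrier A; z \<in> carrier A\<rbrakk>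
          \<Longrightarrow> (x \<oplus> y) \<oplus> z = x \<oplus> (y \<oplus> z)"
    and add_commute: "\<lbrakk>x \<in> carrier A; y \<in> carrier A\<rbrakk> \<Longrightarrow> x \<oplus> y = y \<oplus> x"
    and zero_add: "x \<in> carrier A \<Longrightarrow> \<zero> \<oplus> x = x"
    and add_inverse: "x \<in> carrier A \<Longrightarrow> \<exists>y\<in>carrier A. x \<oplus> y = \<zero>"
    and scale_add_right: "\<lbrakk>x \<in> carrier A; y \<in> carrier A\<rbrakk> \<Longrightarrow> c \<odot> (x \<oplus> y) = c \<odot> x \<oplus> c \<odot> y"
    and scale_add_left: "x \<in> carrier A \<Longrightarrow> (c + d) \<odot> x = c \<odot> x \<oplus> d \<odot> x"
    and scale_scale: "x \<in> carrier A \<Longrightarrow> c \<odot> d \<odot> x = (c * d) \<odot> x"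
    and scale_one: "x \<in> carrier A \<Longrightarrow> 1 \<odot> x = x"
    and mult_assoc: "\<lbrakk>x \<in> carrier A; y \<in> carrier A; z \<in> carrier A\<rbrakk>
          \<Longrightarrow> (x \<otimes> y) \<otimes> z = x \<otimes> (y \<otimes> z)"
    and distrib_right: "\<lbrakk>x \<in> carrier A; y \<in> carrier A; z \<in> carrier A\<rbrakk>
          \<Longrightarrow> (x \<oplus> y) \<otimes> z = x \<otimes> z \<oplus> y \<otimes> z"
    and distrib_left: "\<lbrakk>x \<in> carrier A; y \<in> carrier A; z \<in> carrier A\<rbrakk>
          \<Longrightarrow> x \<otimes> (y \<oplus> z) = x \<otimes> y \<oplus> x \<otimes> z"
    and scale_mult_left: "\<lbrakk>x \<in> carrier A; y \<in> carrier A\<rbrakk> \<Longrightarrow> (c \<odot> x) \<otimes> y = c \<odot> (x \<otimes> y)"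
    and scale_mult_right: "\<lbrakk>x \<in> carrier A; y \<in> carrier A\<rbrakk> \<Longrightarrow> x \<otimes> (c \<odot> y) = c \<odot> (x \<otimes> y)"
    and star_star: "x \<in> carrier A \<Longrightarrow> (x\<^sup>\<star>)\<^sup>\<star> = x"
    and star_add: "\<lbrakk>x \<in> carrier A; y \<in> carrier A\<rbrakk> \<Longrightarrow> (x \<oplus> y)\<^sup>\<star> = x\<^sup>\<star> \<oplus> y\<^sup>\<star>"
    and star_scale: "x \<in> carrier A \<Longrightarrow> (c \<odot> x)\<^sup>\<star> = cnj c \<odot> x\<^sup>\<star>"
    and star_mult: "\<lbrakk>x \<in> carrier A; y \<in> carrier A\<rbrakk> \<Longrightarrow> (x \<otimes> y)\<^sup>\<star> = y\<^sup>\<star> \<otimes> x\<^sup>\<star>"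
    and norm_eq_zero: "x \<in> carrier A \<Longrightarrow> \<parallel>x\<parallel> = 0 \<longleftrightarrow> x = \<zero>"
    and norm_scale: "x \<in> carrier A \<Longrightarrow> \<parallel>c \<odot> x\<parallel> = cmod c * \<parallel>x\<parallel>"
    and norm_triangle: "\<lbrakk>x \<in> carrier A; y \<in> carrier A\<rbrakk> \<Longrightarrow> \<parallel>x \<oplus> y\<parallel> \<le> \<parallel>x\<parallel> + \<parallel>y\<parallel>"
    and norm_mult: "\<lbrakk>x \<in> carrier A; y \<in> carrier A\<rbrakk> \<Longrightarrow> \<parallel>x \<otimes> y\<parallel> \<le> \<parallel>x\<parallel> * \<parallel>y\<parallel>"
    and cstar_identity: "x \<in> carrier A \<Longrightarrow> \<parallel>x\<^sup>\<star> \<otimes> x\<parallel> = \<parallel>x\<parallel>\<^sup>2"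
    and complete: "\<lbrakk>\<And>n. s n \<in> carrier A;
           \<And>e. e > 0 \<Longrightarrow> \<exists>N. \<forall>m\<ge>N. \<forall>n\<ge>N. \<parallel>s m \<ominus> s n\<parallel> < e\<rbrakk>
          \<Longrightarrow> \<exists>x\<in>carrier A. (\<lambda>n. \<parallel>s n \<ominus> x\<parallel>) \<longlonglongrightarrow> 0"

definition norm_closed_in :: "('a, 'm) cstar_struct_scheme \<Rightarrow> 'a set \<Rightarrow> bool" where
  "norm_closed_in A S \<longleftrightarrow> S \<subseteq> carrier A \<and>
     (\<forall>s x. (\<forall>n::nat. s n \<in> S) \<and> x \<in> carrier A \<and> (\<lambda>n. \<parallel>s n \<ominus>\<^bsub>A\<^esub> x\<parallel>\<^bsub>A\<^esub>) \<longlonglongrightarrow> 0 \<longrightarrow> x \<in> S)"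

text \<open>A C*-subalgebra is given by its carrier \<open>B\<close>; as a C*-algebra in its own right
  it is \<open>A\<lparr>carrier := B\<rparr>\<close>.\<close>

definition cstar_subalgebra :: "('a, 'm) cstar_struct_scheme \<Rightarrow> 'a set \<Rightarrow> bool" where
  "cstar_subalgebra A B \<longleftrightarrow> norm_closed_in A B \<and> \<zero>\<^bsub>A\<^esub> \<in> B \<and>
     (\<forall>x\<in>B. \<forall>y\<in>B. x \<oplus>\<^bsub>A\<^esub> y \<in> B \<and> x \<otimes>\<^bsub>A\<^esub> y \<in> B) \<and>
     (\<forall>x\<in>B. x\<^sup>\<star>\<^bsub>A\<^esub> \<in> B \<and> (\<forall>c. c \<odot>\<^bsub>A\<^esub> x \<in> B))"

definition is_unit :: "('a, 'm) cstar_struct_scheme \<Rightarrow> 'a \<Rightarrow> bool" where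
  "is_unit A e \<longleftrightarrow> e \<in> carrier A \<and>
     (\<forall>x\<in>carrier A. e \<otimes>\<^bsub>A\<^esub> x = x \<and> x \<otimes>\<^bsub>A\<^esub> e = x)"

definition unital :: "('a, 'm) cstar_struct_scheme \<Rightarrow> bool" where
  "unital A \<longleftrightarrow> (\<exists>e. is_unit A e)"

definition unit :: "('a, 'm) cstar_struct_scheme \<Rightarrow> 'a"  ("\<one>\<index>")
  where "\<one>\<^bsub>A\<^esub> = (THE e. is_unit A e)"

definition closed_ideal :: "('a, 'm) cstar_struct_scheme \<Rightarrow> 'a set \<Rightarrow> bool" where
  "closed_ideal A I \<longleftrightarrow> norm_closed_in A I \<and> \<zero>\<^bsub>A\<^esub> \<in> I \<and>
     (\<forall>x\<in>I. \<forall>y\<in>I. x \<oplus>\<^bsub>A\<^esub> y \<in> I) \<and> (\<forall>x\<in>I. \<forall>c. c \<odot>\<^bsub>A\<^esub> x \<in> I) \<and>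
     (\<forall>x\<in>I. \<forall>y\<in>carrier A. x \<otimes>\<^bsub>A\<^esub> y \<in> I \<and> y \<otimes>\<^bsub>A\<^esub> x \<in> I)"

definition simple :: "('a, 'm) cstar_struct_scheme \<Rightarrow> bool" where
  "simple A \<longleftrightarrow> (\<forall>I. closed_ideal A I \<longrightarrow> I = {\<zero>\<^bsub>A\<^esub>} \<or> I = carrier A)"


section \<open>Spectrum, positivity, functional calculus\<close>

text \<open>Product of the unitization \<open>\<complex> \<times> A\<close>, in which \<open>(c, x)\<close> stands for \<open>c1 + x\<close>.\<close>

fun unitization_mult ::
    "('a, 'm) cstar_struct_scheme \<Rightarrow> complex \<times> 'a \<Rightarrow> complex \<times> 'a \<Rightarrow> complex \<times> 'a" where
  "unitization_mult A (c, x) (d, y) =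
     (c * d, c \<odot>\<^bsub>A\<^esub> y \<oplus>\<^bsub>A\<^esub> d \<odot>\<^bsub>A\<^esub> x \<oplus>\<^bsub>A\<^esub> x \<otimes>\<^bsub>A\<^esub> y)"

text \<open>The spectrum is taken in \<open>A\<close> if \<open>A\<close> is unital and in the unitization otherwise.\<close>

definition spectrum :: "('a, 'm) cstar_struct_scheme \<Rightarrow> 'a \<Rightarrow> complex set" where
  "spectrum A a =
     (if unital A then
        {c. \<not> (\<exists>b\<in>carrier A. (a \<ominus>\<^bsub>A\<^esub> c \<odot>\<^bsub>A\<^esub> \<one>\<^bsub>A\<^esub>) \<otimes>\<^bsub>A\<^esub> b = \<one>\<^bsub>A\<^esub> \<and>
                            b \<otimes>\<^bsub>A\<^esub> (a \<ominus>\<^bsub>A\<^esub> c \<odot>\<^bsub>A\<^esub> \<one>\<^bsub>A\<^esub>) = \<one>\<^bsub>A\<^esub>)}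
      else
        {c. \<not> (\<exists>d. \<exists>b\<in>carrier A. unitization_mult A (- c, a) (d, b) = (1, \<zero>\<^bsub>A\<^esub>) \<and>
                                unitization_mult A (d, b) (- c, a) = (1, \<zero>\<^bsub>A\<^esub>))})"

definition positive :: "('a, 'm) cstar_struct_scheme \<Rightarrow> 'a \<Rightarrow> bool" where
  "positive A a \<longleftrightarrow> a \<in> carrier A \<and> a\<^sup>\<star>\<^bsub>A\<^esub> = a \<and> spectrum A a \<subseteq> complex_of_real ` {0..}"

definition cle :: "('a, 'm) cstar_struct_scheme \<Rightarrow> 'a \<Rightarrow> 'a \<Rightarrow> bool" where
  "cle A x y \<longleftrightarrow> x \<in> carrier A \<and> y \<in> carrier A \<and> positive A (y \<ominus>\<^bsub>A\<^esub> x)"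

text \<open>For \<open>p = c\<^sub>0 + c\<^sub>1 t + \<dots>\<close> this is \<open>c\<^sub>0 a + c\<^sub>1 a\<^sup>2 + \<dots>\<close>, i.e. the polynomial \<open>t p(t)\<close>
  evaluated at \<open>a\<close>; every polynomial without constant term has this form.\<close>

definition poly_at :: "('a, 'm) cstar_struct_scheme \<Rightarrow> real poly \<Rightarrow> 'a \<Rightarrow> 'a" where
  "poly_at A p a =
     fold_coeffs (\<lambda>c x. complex_of_real c \<odot>\<^bsub>A\<^esub> a \<oplus>\<^bsub>A\<^esub> a \<otimes>\<^bsub>A\<^esub> x) p \<zero>\<^bsub>A\<^esub>"

text \<open>Continuous functional calculus \<open>f(a)\<close> for self-adjoint \<open>a\<close> and continuous real \<open>f\<close> with
  \<open>f(0) = 0\<close>: the common limit of \<open>q\<^sub>n(a)\<close> over all sequences of real polynomials \<open>q\<^sub>n\<close> without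
  constant term that converge to \<open>f\<close> uniformly on the spectrum of \<open>a\<close>. Such sequences exist
  by Weierstrass, and the absence of constant terms keeps \<open>q\<^sub>n(a)\<close> in a nonunital \<open>A\<close>.\<close>

definition fun_calc :: "('a, 'm) cstar_struct_scheme \<Rightarrow> (real \<Rightarrow> real) \<Rightarrow> 'a \<Rightarrow> 'a" where
  "fun_calc A f a =
     (THE b. b \<in> carrier A \<and>
        (\<forall>p :: nat \<Rightarrow> real poly.
           uniform_limit {t. complex_of_real t \<in> spectrum A a} (\<lambda>n t. t * poly (p n) t) f sequentially
           \<longrightarrow> (\<lambda>n. \<parallel>poly_at A (p n) a \<ominus>\<^bsub>A\<^esub> b\<parallel>\<^bsub>A\<^esub>) \<longlonglongrightarrow> 0))"

definition cut_down :: "('a, 'm) cstar_struct_scheme \<Rightarrow> 'a \<Rightarrow> real \<Rightarrow> 'a" where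
  "cut_down A a \<epsilon> = fun_calc A (\<lambda>t. max 0 (t - \<epsilon>)) a"


section \<open>Property SP\<close>

definition hereditary_subalgebra :: "('a, 'm) cstar_struct_scheme \<Rightarrow> 'a set \<Rightarrow> bool" where
  "hereditary_subalgebra A H \<longleftrightarrow> cstar_subalgebra A H \<and>
     (\<forall>x\<in>carrier A. \<forall>y\<in>H. positive A x \<and> cle A x y \<longrightarrow> x \<in> H)"

definition projection :: "('a, 'm) cstar_struct_scheme \<Rightarrow> 'a \<Rightarrow> bool" where
  "projection A p \<longleftrightarrow> p \<in> carrier A \<and> p\<^sup>\<star>\<^bsub>A\<^esub> = p \<and> p \<otimes>\<^bsub>A\<^esub> p = p"

definition property_SP :: "('a, 'm) cstar_struct_scheme \<Rightarrow> bool" where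
  "property_SP A \<longleftrightarrow>
     (\<forall>H. hereditary_subalgebra A H \<and> H \<noteq> {\<zero>\<^bsub>A\<^esub>} \<longrightarrow> (\<exists>p\<in>H. projection A p \<and> p \<noteq> \<zero>\<^bsub>A\<^esub>))"


section \<open>Matrices over a C*-algebra and Cuntz subequivalence\<close>

primrec csum :: "('a, 'm) cstar_struct_scheme \<Rightarrow> (nat \<Rightarrow> 'a) \<Rightarrow> nat \<Rightarrow> 'a" where
  "csum A s 0 = \<zero>\<^bsub>A\<^esub>"
| "csum A s (Suc n) = csum A s n \<oplus>\<^bsub>A\<^esub> s n"

text \<open>\<open>M\<^sub>\<infinity>(A)\<close> consists of the infinite matrices that vanish outside some upper left-hand
  \<open>n \<times> n\<close> block; \<open>msize\<close> is the least such \<open>n\<close>.\<close>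

definition msize :: "('a, 'm) cstar_struct_scheme \<Rightarrow> (nat \<Rightarrow> nat \<Rightarrow> 'a) \<Rightarrow> nat" where
  "msize A T = (LEAST n. \<forall>i j. n \<le> i \<or> n \<le> j \<longrightarrow> T i j = \<zero>\<^bsub>A\<^esub>)"

text \<open>The C*-norm of \<open>M\<^sub>n(A)\<close> is the operator norm of its action by left multiplication
  on the Hilbert \<open>A\<close>-module \<open>A\<^sup>n\<close> of columns, where \<open>\<parallel>\<xi>\<parallel>\<close> is the
  square root of \<open>\<parallel>\<Sum>\<^sub>i \<xi>\<^sub>i\<^sup>\<star> \<xi>\<^sub>i\<parallel>\<close>.\<close>

definition column_norm :: "('a, 'm) cstar_struct_scheme \<Rightarrow> nat \<Rightarrow> (nat \<Rightarrow> 'a) \<Rightarrow> real" where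
  "column_norm A n \<xi> = sqrt \<parallel>csum A (\<lambda>i. (\<xi> i)\<^sup>\<star>\<^bsub>A\<^esub> \<otimes>\<^bsub>A\<^esub> \<xi> i) n\<parallel>\<^bsub>A\<^esub>"

definition matrix_norm :: "('a, 'm) cstar_struct_scheme \<Rightarrow> (nat \<Rightarrow> nat \<Rightarrow> 'a) \<Rightarrow> real" where
  "matrix_norm A T =
     (let n = msize A T in
       SUP \<xi>\<in>{\<xi>. (\<forall>j<n. \<xi> j \<in> carrier A) \<and> column_norm A n \<xi> \<le> 1}.
         column_norm A n (\<lambda>i. csum A (\<lambda>j. T i j \<otimes>\<^bsub>A\<^esub> \<xi> j) n))"

definition M_infty :: "('a, 'm) cstar_struct_scheme \<Rightarrow> (nat \<Rightarrow> nat \<Rightarrow> 'a) cstar_struct" where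
  "M_infty A = \<lparr>
     carrier = {T. (\<forall>i j. T i j \<in> carrier A) \<and>
                   (\<exists>n. \<forall>i j. n \<le> i \<or> n \<le> j \<longrightarrow> T i j = \<zero>\<^bsub>A\<^esub>)},
     czero = (\<lambda>i j. \<zero>\<^bsub>A\<^esub>),
     cadd = (\<lambda>S T i j. S i j \<oplus>\<^bsub>A\<^esub> T i j),
     cmult = (\<lambda>S T i j. csum A (\<lambda>k. S i k \<otimes>\<^bsub>A\<^esub> T k j) (msize A S)),
     cscale = (\<lambda>c T i j. c \<odot>\<^bsub>A\<^esub> T i j),
     cstar = (\<lambda>T i j. (T j i)\<^sup>\<star>\<^bsub>A\<^esub>),
     cnorm = matrix_norm A\<rparr>"

definition corner :: "('a, 'm) cstar_struct_scheme \<Rightarrow> 'a \<Rightarrow> nat \<Rightarrow> nat \<Rightarrow> 'a" where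
  "corner A a = (\<lambda>i j. if i = 0 \<and> j = 0 then a else \<zero>\<^bsub>A\<^esub>)"

text \<open>Meaningful for positive \<open>a\<close> and \<open>b\<close> in \<open>M\<^sub>\<infinity>(A)\<close>.\<close>

definition cuntz_le ::
    "('a, 'm) cstar_struct_scheme \<Rightarrow> (nat \<Rightarrow> nat \<Rightarrow> 'a) \<Rightarrow> (nat \<Rightarrow> nat \<Rightarrow> 'a) \<Rightarrow> bool" where
  "cuntz_le A a b \<longleftrightarrow>
     (\<exists>v. (\<forall>n::nat. v n \<in> carrier (M_infty A)) \<and>
       (\<lambda>n. \<parallel>v n \<otimes>\<^bsub>M_infty A\<^esub> b \<otimes>\<^bsub>M_infty A\<^esub> (v n)\<^sup>\<star>\<^bsub>M_infty A\<^esub> \<ominus>\<^bsub>M_infty A\<^esub> a\<parallel>\<^bsub>M_infty A\<^esub>)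
         \<longlonglongrightarrow> 0)"


section \<open>The class gTA\<open>\<Omega>\<close>\<close>

definition near :: "('a, 'm) cstar_struct_scheme \<Rightarrow> real \<Rightarrow> 'a \<Rightarrow> 'a set \<Rightarrow> bool" where
  "near A \<epsilon> x B \<longleftrightarrow> (\<exists>b\<in>B. \<parallel>x \<ominus>\<^bsub>A\<^esub> b\<parallel>\<^bsub>A\<^esub> < \<epsilon>)"

definition gTA :: "'a cstar_struct set \<Rightarrow> 'a cstar_struct set" where
  "gTA \<Omega> = {A. cstar_algebra A \<and> simple A \<and>
     (\<forall>\<epsilon>>0. \<forall>F a y. finite F \<and> F \<subseteq> carrier A \<and> positive A a \<and> positive A y \<and> a \<noteq> \<zero>\<^bsub>A\<^esub> \<longrightarrow>
       (\<exists>B g. cstar_subalgebra A B \<and> A\<lparr>carrier := B\<rparr> \<in> \<Omega> \<and>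
          positive (A\<lparr>carrier := B\<rparr>) g \<and> \<parallel>g\<parallel>\<^bsub>A\<^esub> \<le> 1 \<and>
          (\<forall>x\<in>F. \<parallel>x \<otimes>\<^bsub>A\<^esub> g \<ominus>\<^bsub>A\<^esub> g \<otimes>\<^bsub>A\<^esub> x\<parallel>\<^bsub>A\<^esub> < \<epsilon>) \<and>
          (\<forall>x\<in>F. near A \<epsilon> (g \<otimes>\<^bsub>A\<^esub> x) B \<and> near A \<epsilon> (x \<otimes>\<^bsub>A\<^esub> g) B) \<and>
          cuntz_le A
            (corner A (cut_down A (y \<otimes>\<^bsub>A\<^esub> y \<ominus>\<^bsub>A\<^esub> y \<otimes>\<^bsub>A\<^esub> g \<otimes>\<^bsub>A\<^esub> y) \<epsilon>))
            (corner A a) \<and>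
          \<parallel>g \<otimes>\<^bsub>A\<^esub> a \<otimes>\<^bsub>A\<^esub> g\<parallel>\<^bsub>A\<^esub> \<ge> \<parallel>a\<parallel>\<^bsub>A\<^esub> - \<epsilon>))}"

end

theory Submission
  imports Defs
begin

text \<open>Take a self-adjoint \<open>h\<close> of norm \<open>1\<close> in the hereditary subalgebra \<open>H\<close> and apply the definition of
  \<open>gTA\<Omega>\<close> to \<open>h\<^sup>2\<close>. This gives \<open>B\<close> and \<open>g\<close> such that \<open>g h\<^sup>2 g\<close> is nearly of norm \<open>1\<close> and close to a
  self-adjoint \<open>b \<in> B\<close>. Property SP of \<open>B\<close>, applied to the annihilator in \<open>B\<close> of the negative part of
  \<open>b - 1/2\<close>, yields a projection \<open>p \<in> B\<close> with \<open>p b p \<ge> p/2\<close>. Hence \<open>p g h\<^sup>2 g p = yy\<^sup>*\<close>, with \<open>y = p g h\<close>,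
  is invertible in \<open>pAp\<close>, and if \<open>f\<close> is its inverse there, \<open>y\<^sup>* f y \<in> hAh\<close> is a non-zero projection in \<open>H\<close>.

  Continuous functional calculus is avoided: the only functions needed are square roots, obtained by
  iteration, and positivity is handled as being the square of a self-adjoint element.\<close>

text \<open>The natural cut would be the spectral projection of \<open>b\<close> for [1/2,
  \<infinity>), but a C*-algebra need not contain spectral projections. Property SP only gives some
  projection inside a hereditary subalgebra, so an annihilator stands in for the spectral subspace.
  The projection \<open>p\<close> found there lies in \<open>B\<close>, not in \<open>H\<close>; it
  is moved by a Murray-von Neumann equivalence. Formally \<open>f\<^sup>1\<^sup>/\<^sup>2 y\<close>
  has range projection \<open>p\<close> and source projection \<open>y\<^sup>\<star> f y\<close>,
  and the latter formula needs no root of \<open>f\<close>.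

  The obstacle is the passage between \<open>B\<close> and \<open>A\<close>: \<open>B\<close> may
  have no unit, or a unit different from that of \<open>A\<close>, while positivity refers to the
  spectrum in the algebra at hand. Positivity is therefore carried from \<open>B\<close> to
  \<open>A\<close> once, by comparing spectra, and shifts such as \<open>b - 1/2\<close> and their
  absolute values are formed in \<open>A\<close>. Each root is a limit of polynomials, recorded by
  the clause that it lies in every closed unital subalgebra containing the radicand. This single
  clause yields both that roots commute with what they should and that they multiply
  \<open>B\<close> into \<open>B\<close>.\<close>

lemma is_unit_unique: "is_unit A e \<Longrightarrow> is_unit A f \<Longrightarrow> e = f"
  unfolding is_unit_def by metis

lemma unit_is_unit: "unital A \<Longrightarrow> is_unit A \<one>\<^bsub>A\<^esub>"
  unfolding unital_def unit_def by (metis is_unit_unique theI)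

section \<open>Linear and norm arithmetic from the axioms, relative to the carrier\<close>

context cstar_algebra begin

lemmas closed_basic = zero_closed add_closed mult_closed scale_closed star_closed

lemma minus_closed: "x \<in> carrier A \<Longrightarrow> y \<in> carrier A \<Longrightarrow> x \<ominus> y \<in> carrier A"
  by (simp add: cminus_def closed_basic)

text \<open>Homogeneity gives norm 0, and definiteness of the norm does the rest; the other rules
  for \<zero> follow by scaling with 0.\<close>

lemma scale_zero_left: "x \<in> carrier A \<Longrightarrow> 0 \<odot> x = \<zero>"
  using norm_eq_zero[of "0 \<odot> x"] norm_scale[of x 0] by (simp add: closed_basic)

lemma scale_zero_right: "c \<odot> \<zero> = \<zero>"
  using scale_scale[of "\<zero>" c 0] by (simp add: closed_basic scale_zero_left)

lemma add_zero: "x \<in> carrier A \<Longrightarrow> x \<oplus> \<zero> = x"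
  using add_commute[of x "\<zero>"] by (simp add: closed_basic zero_add)

lemma mult_zero_right: "x \<in> carrier A \<Longrightarrow> x \<otimes> \<zero> = \<zero>"
  using scale_mult_right[of x "\<zero>" 0] by (simp add: closed_basic scale_zero_left)

lemma mult_zero_left: "x \<in> carrier A \<Longrightarrow> \<zero> \<otimes> x = \<zero>"
  using scale_mult_left[of "\<zero>" x 0] by (simp add: closed_basic scale_zero_left)

lemma star_zero: "\<zero>\<^sup>\<star> = \<zero>"
  using star_scale[of "\<zero>" 0] by (simp add: closed_basic scale_zero_left)

lemma minus_self: "x \<in> carrier A \<Longrightarrow> x \<ominus> x = \<zero>"
  using scale_add_left[of x 1 "-1"] by (simp add: cminus_def scale_one scale_zero_left)

lemma minus_eq_zero_iff:
  assumes "x \<in> carrier A" "y \<in> carrier A"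
  shows "x \<ominus> y = \<zero> \<longleftrightarrow> x = y"
proof
  assume e: "x \<ominus> y = \<zero>"
  have "x = x \<oplus> ((-1) \<odot> y \<oplus> y)"
    using minus_self[OF assms(2)] assms
    by (simp add: cminus_def add_commute closed_basic add_zero)
  also have "\<dots> = (x \<ominus> y) \<oplus> y" using assms by (simp add: cminus_def add_assoc closed_basic)
  finally show "x = y" using e assms by (simp add: zero_add)
qed (use assms minus_self in simp)

lemma norm_zero: "\<parallel>\<zero>\<parallel> = 0"
  using norm_eq_zero zero_closed by blast

lemma norm_neg: "x \<in> carrier A \<Longrightarrow> \<parallel>(-1) \<odot> x\<parallel> = \<parallel>x\<parallel>"
  by (simp add: norm_scale)

text \<open>Not an axiom: the triangle inequality for \<open>x\<close> and \<open>-x\<close> gives 0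
  \<le> 2 \<open>\<parallel>x\<parallel>\<close>.\<close>

lemma norm_nonneg: "x \<in> carrier A \<Longrightarrow> 0 \<le> \<parallel>x\<parallel>"
  using norm_triangle[of x "(-1) \<odot> x"] minus_self[of x]
  by (simp add: cminus_def norm_zero norm_neg closed_basic)

text \<open>The C*-identity bounds the square of the norm of \<open>y\<close> by the product of the
  norms of \<open>y\<^sup>\<star>\<close> and \<open>y\<close>; cancel one factor, then apply the
  inequality to \<open>x\<close> and to its star.\<close>

lemma norm_star: assumes "x \<in> carrier A" shows "\<parallel>x\<^sup>\<star>\<parallel> = \<parallel>x\<parallel>"
proof -
  have le: "\<parallel>y\<parallel> \<le> \<parallel>y\<^sup>\<star>\<parallel>" if "y \<in> carrier A" for y
  proof (cases "\<parallel>y\<parallel> = 0")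
    case False
    have "\<parallel>y\<parallel>\<^sup>2 \<le> \<parallel>y\<^sup>\<star>\<parallel> * \<parallel>y\<parallel>"
      using cstar_identity[OF that] norm_mult[of "y\<^sup>\<star>" y] that by (simp add: closed_basic)
    then show ?thesis using False norm_nonneg[OF that] by (simp add: power2_eq_square)
  qed (use that in \<open>simp add: norm_nonneg closed_basic\<close>)
  show ?thesis using le[OF assms] le[of "x\<^sup>\<star>"] assms by (simp add: closed_basic star_star)
qed

lemma norm_square: "x \<in> carrier A \<Longrightarrow> x\<^sup>\<star> = x \<Longrightarrow> \<parallel>x \<otimes> x\<parallel> = \<parallel>x\<parallel>\<^sup>2"
  using cstar_identity[of x] by simp

end

section \<open>Deciding identities of *-polynomials\<close>

text \<open>Identities in noncommuting variables are proved by reflection; \<open>Herm\<close> letters stand for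
  self-adjoint elements, on which the star acts trivially. A *-polynomial is an unsorted list of
  monomials, possibly with repeated words.\<close>

datatype letter = Gen nat | GenStar nat | Herm nat

primrec letter_star :: "letter \<Rightarrow> letter" where
  "letter_star (Gen n) = GenStar n"
| "letter_star (GenStar n) = Gen n"
| "letter_star (Herm n) = Herm n"

type_synonym star_poly = "(complex \<times> letter list) list"

primrec star_poly_mult :: "star_poly \<Rightarrow> star_poly \<Rightarrow> star_poly" where
  "star_poly_mult [] q = []"
| "star_poly_mult (m # p) q = map (\<lambda>n. (fst m * fst n, snd m @ snd n)) q @ star_poly_mult p q"

primrec word_coeff :: "letter list \<Rightarrow> star_poly \<Rightarrow> complex" where
  "word_coeff w [] = 0"
| "word_coeff w (m # p) = (if snd m = w then fst m + word_coeff w p else word_coeff w p)"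

text \<open>A test for vanishing in the free algebra: collect the coefficients of the leading word,
  delete that word, continue. No order on words is needed, and coefficients may stay symbolic, so
  conditions such as \<open>c * (1 / c) = 1\<close> are left to the simplifier.\<close>

fun star_poly_zero :: "star_poly \<Rightarrow> bool" where
  "star_poly_zero [] = True"
| "star_poly_zero (m # p) =
     (fst m + word_coeff (snd m) p = 0 \<and> star_poly_zero (filter (\<lambda>n. snd n \<noteq> snd m) p))"

locale unital_cstar_algebra = cstar_algebra +
  assumes unital: "unital A"
begin

lemma one_closed: "\<one> \<in> carrier A"
  and one_mult: "x \<in> carrier A \<Longrightarrow> \<one> \<otimes> x = x"
  and mult_one: "x \<in> carrier A \<Longrightarrow> x \<otimes> \<one> = x"
  using unit_is_unit[OF unital] by (auto simp: is_unit_def)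

lemmas closed [simp] = closed_basic minus_closed one_closed
lemmas unit_simps [simp] = one_mult mult_one zero_add add_zero mult_zero_left mult_zero_right
  scale_zero_left scale_zero_right scale_one minus_self norm_zero star_zero star_star

lemma star_one [simp]: "\<one>\<^sup>\<star> = \<one>"
  using mult_one[of "\<one>\<^sup>\<star>"] star_mult[of "\<one>\<^sup>\<star>" "\<one>"] by simp

lemma norm_projection_le:
  assumes "p \<in> carrier A" "p\<^sup>\<star> = p" "p \<otimes> p = p" shows "\<parallel>p\<parallel> \<le> 1"
proof -
  have "\<parallel>p\<parallel>\<^sup>2 = \<parallel>p\<parallel>" using norm_square[of p] assms by simp
  then show ?thesis by (auto simp: power2_eq_square)
qed

text \<open>Only an inequality, because the zero algebra is unital too and its unit has norm
  0.\<close>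

lemma norm_one_le: "\<parallel>\<one>\<parallel> \<le> 1"
  by (rule norm_projection_le) simp_all

section \<open>Evaluation of words and polynomials in a unital C*-algebra\<close>

primrec letter_eval :: "'a list \<Rightarrow> 'a list \<Rightarrow> letter \<Rightarrow> 'a" where
  "letter_eval xs ys (Gen n) = xs ! n"
| "letter_eval xs ys (GenStar n) = (xs ! n)\<^sup>\<star>"
| "letter_eval xs ys (Herm n) = ys ! n"

fun letter_bound :: "'a list \<Rightarrow> 'a list \<Rightarrow> letter \<Rightarrow> bool" where
  "letter_bound xs ys (Gen n) = (n < length xs)"
| "letter_bound xs ys (GenStar n) = (n < length xs)"
| "letter_bound xs ys (Herm n) = (n < length ys)"

primrec word_eval :: "'a list \<Rightarrow> 'a list \<Rightarrow> letter list \<Rightarrow> 'a" where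
  "word_eval xs ys [] = \<one>"
| "word_eval xs ys (l # w) = letter_eval xs ys l \<otimes> word_eval xs ys w"

primrec star_poly_eval :: "'a list \<Rightarrow> 'a list \<Rightarrow> star_poly \<Rightarrow> 'a" where
  "star_poly_eval xs ys [] = \<zero>"
| "star_poly_eval xs ys (m # p) = fst m \<odot> word_eval xs ys (snd m) \<oplus> star_poly_eval xs ys p"

definition good_env :: "'a list \<Rightarrow> 'a list \<Rightarrow> bool" where
  "good_env xs ys \<longleftrightarrow> (\<forall>x\<in>set xs. x \<in> carrier A) \<and> (\<forall>y\<in>set ys. y \<in> carrier A \<and> y\<^sup>\<star> = y)"

definition good_word :: "'a list \<Rightarrow> 'a list \<Rightarrow> letter list \<Rightarrow> bool" where
  "good_word xs ys w \<longleftrightarrow> (\<forall>l\<in>set w. letter_bound xs ys l)"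

definition good_poly :: "'a list \<Rightarrow> 'a list \<Rightarrow> star_poly \<Rightarrow> bool" where
  "good_poly xs ys p \<longleftrightarrow> (\<forall>m\<in>set p. good_word xs ys (snd m))"

text \<open>The condition on the environment sits inside the implication, so that the rules below
  carry no side conditions and a polynomial can be synthesised by resolution along the term
  alone.\<close>

definition represents :: "'a list \<Rightarrow> 'a list \<Rightarrow> star_poly \<Rightarrow> 'a \<Rightarrow> bool" where
  "represents xs ys p x \<longleftrightarrow> (good_env xs ys \<longrightarrow> good_poly xs ys p \<and> star_poly_eval xs ys p = x)"

lemma letter_eval_closed: "good_env xs ys \<Longrightarrow> letter_bound xs ys l \<Longrightarrow> letter_eval xs ys l \<in> carrier A"
  by (cases l) (auto simp: good_env_def)

lemma letter_eval_star:
  "good_env xs ys \<Longrightarrow> letter_bound xs ys l \<Longrightarrow>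
    letter_eval xs ys (letter_star l) = (letter_eval xs ys l)\<^sup>\<star>"
  by (cases l) (auto simp: good_env_def)

lemma word_eval_closed: "good_env xs ys \<Longrightarrow> good_word xs ys w \<Longrightarrow> word_eval xs ys w \<in> carrier A"
  by (induction w) (auto simp: letter_eval_closed good_word_def)

lemma word_eval_append:
  "good_env xs ys \<Longrightarrow> good_word xs ys w \<Longrightarrow> good_word xs ys v \<Longrightarrow>
    word_eval xs ys (w @ v) = word_eval xs ys w \<otimes> word_eval xs ys v"
  using word_eval_closed[of xs ys] letter_eval_closed[of xs ys]
  by (induction w) (auto simp: good_word_def mult_assoc)

lemma letter_bound_star [simp]: "letter_bound xs ys (letter_star l) = letter_bound xs ys l"
  by (cases l) auto

lemma word_eval_star:
  "good_env xs ys \<Longrightarrow> good_word xs ys w \<Longrightarrow>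
    word_eval xs ys (rev (map letter_star w)) = (word_eval xs ys w)\<^sup>\<star>"
proof (induction w)
  case (Cons l w)
  have g: "good_word xs ys w" "letter_bound xs ys l" "good_word xs ys (rev (map letter_star w))"
    "good_word xs ys [letter_star l]"
    using Cons.prems by (auto simp: good_word_def)
  show ?case
    using Cons.IH[OF Cons.prems(1) g(1)] g Cons.prems(1)
    by (simp add: word_eval_append star_mult word_eval_closed letter_eval_closed letter_eval_star)
qed simp

lemma star_poly_eval_closed:
  "good_env xs ys \<Longrightarrow> good_poly xs ys p \<Longrightarrow> star_poly_eval xs ys p \<in> carrier A"
  by (induction p) (auto simp: word_eval_closed good_poly_def)

lemma star_poly_eval_append:
  "good_env xs ys \<Longrightarrow> good_poly xs ys p \<Longrightarrow> good_poly xs ys q \<Longrightarrow>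
    star_poly_eval xs ys (p @ q) = star_poly_eval xs ys p \<oplus> star_poly_eval xs ys q"
  using star_poly_eval_closed[of xs ys]
  by (induction p) (auto simp: good_poly_def word_eval_closed add_assoc)

lemma star_poly_eval_scale:
  "good_env xs ys \<Longrightarrow> good_poly xs ys p \<Longrightarrow>
    star_poly_eval xs ys (map (\<lambda>m. (c * fst m, snd m)) p) = c \<odot> star_poly_eval xs ys p"
  using star_poly_eval_closed[of xs ys]
  by (induction p) (auto simp: good_poly_def word_eval_closed scale_add_right scale_scale)

lemma star_poly_eval_monomial_mult:
  "good_env xs ys \<Longrightarrow> good_word xs ys w \<Longrightarrow> good_poly xs ys p \<Longrightarrow>
    star_poly_eval xs ys (map (\<lambda>n. (c * fst n, w @ snd n)) p)
      = (c \<odot> word_eval xs ys w) \<otimes> star_poly_eval xs ys p"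
  using star_poly_eval_closed[of xs ys]
  by (induction p) (auto simp: good_poly_def word_eval_closed word_eval_append distrib_left
      scale_mult_left scale_mult_right scale_scale mult.commute)

lemma good_poly_mult:
  "good_poly xs ys p \<Longrightarrow> good_poly xs ys q \<Longrightarrow> good_poly xs ys (star_poly_mult p q)"
  by (induction p) (auto simp: good_poly_def good_word_def)

lemma star_poly_eval_mult:
  "good_env xs ys \<Longrightarrow> good_poly xs ys p \<Longrightarrow> good_poly xs ys q \<Longrightarrow>
    star_poly_eval xs ys (star_poly_mult p q) = star_poly_eval xs ys p \<otimes> star_poly_eval xs ys q"
proof (induction p)
  case (Cons m p)
  have g: "good_word xs ys (snd m)" "good_poly xs ys p" using Cons.prems by (auto simp: good_poly_def)
  have "good_poly xs ys (map (\<lambda>n. (fst m * fst n, snd m @ snd n)) q)"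
    using g Cons.prems by (auto simp: good_poly_def good_word_def)
  then show ?case using Cons.IH[OF Cons.prems(1) g(2) Cons.prems(3)] g Cons.prems
    by (simp add: star_poly_eval_append star_poly_eval_monomial_mult good_poly_mult distrib_right
        word_eval_closed star_poly_eval_closed)
qed (simp add: star_poly_eval_closed)

lemma star_poly_eval_star:
  "good_env xs ys \<Longrightarrow> good_poly xs ys p \<Longrightarrow>
    star_poly_eval xs ys (map (\<lambda>m. (cnj (fst m), rev (map letter_star (snd m)))) p)
      = (star_poly_eval xs ys p)\<^sup>\<star>"
  using star_poly_eval_closed[of xs ys]
  by (induction p) (auto simp: good_poly_def word_eval_closed star_add star_scale word_eval_star)

lemma star_poly_eval_extract:
  "good_env xs ys \<Longrightarrow> good_poly xs ys p \<Longrightarrow> good_word xs ys w \<Longrightarrow>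
    star_poly_eval xs ys p
      = word_coeff w p \<odot> word_eval xs ys w \<oplus> star_poly_eval xs ys (filter (\<lambda>n. snd n \<noteq> w) p)"
proof (induction p)
  case (Cons m p)
  let ?r = "star_poly_eval xs ys (filter (\<lambda>n. snd n \<noteq> w) p)"
  have g: "good_word xs ys (snd m)" "good_poly xs ys p" "good_poly xs ys (filter (\<lambda>n. snd n \<noteq> w) p)"
    using Cons.prems by (auto simp: good_poly_def)
  note IH = Cons.IH[OF Cons.prems(1) g(2) Cons.prems(3)]
  have c: "word_eval xs ys w \<in> carrier A" "word_eval xs ys (snd m) \<in> carrier A" "?r \<in> carrier A"
    using g Cons.prems by (simp_all add: word_eval_closed star_poly_eval_closed)
  have "a \<oplus> (b \<oplus> r) = b \<oplus> (a \<oplus> r)"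
    if "a \<in> carrier A" "b \<in> carrier A" "r \<in> carrier A" for a b r
    using that by (metis add_assoc add_commute)
  then show ?case using c IH by (auto simp: scale_add_left add_assoc)
qed (simp add: word_eval_closed)

lemma star_poly_zero_eval:
  "good_env xs ys \<Longrightarrow> good_poly xs ys p \<Longrightarrow> star_poly_zero p \<Longrightarrow> star_poly_eval xs ys p = \<zero>"
proof (induction p rule: star_poly_zero.induct)
  case (2 m p)
  have g: "good_word xs ys (snd m)" "good_poly xs ys p"
    "good_poly xs ys (filter (\<lambda>n. snd n \<noteq> snd m) p)"
    using 2 by (auto simp: good_poly_def)
  have "star_poly_eval xs ys (m # p) = (fst m + word_coeff (snd m) p) \<odot> word_eval xs ys (snd m)
      \<oplus> star_poly_eval xs ys (filter (\<lambda>n. snd n \<noteq> snd m) p)"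
    using star_poly_eval_extract[OF 2(2) g(2,1)] 2(2) g
    by (simp add: scale_add_left word_eval_closed star_poly_eval_closed add_assoc)
  then show ?case using 2 g by (simp add: word_eval_closed)
qed simp

lemma represents_mult:
  "represents xs ys p x \<Longrightarrow> represents xs ys q y \<Longrightarrow> represents xs ys (star_poly_mult p q) (x \<otimes> y)"
  by (auto simp: represents_def good_poly_mult star_poly_eval_mult)

lemma represents_add:
  "represents xs ys p x \<Longrightarrow> represents xs ys q y \<Longrightarrow> represents xs ys (p @ q) (x \<oplus> y)"
  by (auto simp: represents_def star_poly_eval_append) (auto simp: good_poly_def)

lemma represents_scale:
  "represents xs ys p x \<Longrightarrow> represents xs ys (map (\<lambda>m. (c * fst m, snd m)) p) (c \<odot> x)"
  by (auto simp: represents_def star_poly_eval_scale) (auto simp: good_poly_def)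

lemma represents_minus:
  "represents xs ys p x \<Longrightarrow> represents xs ys q y \<Longrightarrow>
    represents xs ys (p @ map (\<lambda>m. (-1 * fst m, snd m)) q) (x \<ominus> y)"
  unfolding cminus_def by (intro represents_add represents_scale)

lemma represents_star:
  "represents xs ys p x \<Longrightarrow>
    represents xs ys (map (\<lambda>m. (cnj (fst m), rev (map letter_star (snd m)))) p) (x\<^sup>\<star>)"
  by (auto simp: represents_def star_poly_eval_star) (auto simp: good_poly_def good_word_def)

lemma represents_zero: "represents xs ys [] \<zero>"
  and represents_one: "represents xs ys [(1, [])] \<one>"
  by (auto simp: represents_def good_poly_def good_word_def)

text \<open>The leaves of the synthesis: a variable is looked up by discarding heads of the
  environment lists until it matches, and the list that contains it decides whether it becomes a
  general or a self-adjoint letter.\<close>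

lemma represents_gen_0: "represents (x # xs) ys [(1, [Gen 0])] x"
  and represents_herm_0: "represents xs (y # ys) [(1, [Herm 0])] y"
  by (auto simp: represents_def good_poly_def good_word_def good_env_def)

lemma represents_gen_Suc:
  "represents xs ys [(1, [Gen n])] x \<Longrightarrow> represents (y # xs) ys [(1, [Gen (Suc n)])] x"
  and represents_herm_Suc:
  "represents xs ys [(1, [Herm n])] x \<Longrightarrow> represents xs (y # ys) [(1, [Herm (Suc n)])] x"
  by (auto simp: represents_def good_poly_def good_word_def good_env_def)

lemmas represent = represents_mult represents_add represents_minus represents_scale represents_star
  represents_zero represents_one represents_gen_0 represents_herm_0
  represents_gen_Suc represents_herm_Suc

text \<open>With concrete environments, resolution with \<open>represent\<close> instantiates
  \<open>p\<close> and \<open>q\<close>, and the simplifier settles membership and the vanishing of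
  the difference. Only identities of the free algebra are within reach; known relations, such as
  commutation, therefore appear below as explicit terms added to one side and then rewritten to
  \<zero>.\<close>

lemma algebraic_identity:
  assumes "represents xs ys p x" "represents xs ys q y"
    and env: "good_env xs ys" and zero: "star_poly_zero (p @ map (\<lambda>m. (-1 * fst m, snd m)) q)"
  shows "x = y"
proof -
  have p: "good_poly xs ys p" "star_poly_eval xs ys p = x"
    and q: "good_poly xs ys q" "star_poly_eval xs ys q = y"
    using assms(1,2) env by (auto simp: represents_def)
  have "represents xs ys (p @ map (\<lambda>m. (-1 * fst m, snd m)) q) (x \<ominus> y)"
    using assms by (intro represents_minus)
  then have "x \<ominus> y = \<zero>" using star_poly_zero_eval[OF env _ zero] env by (auto simp: represents_def)
  moreover have "x \<in> carrier A" "y \<in> carrier A"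
    using p q env star_poly_eval_closed by blast+
  ultimately show ?thesis by (simp add: minus_eq_zero_iff)
qed

lemma good_env_simps [simp]:
  "good_env [] []"
  "good_env (x # xs) ys \<longleftrightarrow> x \<in> carrier A \<and> good_env xs ys"
  "good_env [] (y # ys) \<longleftrightarrow> y \<in> carrier A \<and> y\<^sup>\<star> = y \<and> good_env [] ys"
  by (auto simp: good_env_def)

section \<open>Inverses and square roots\<close>

lemma norm_minus_commute:
  assumes "x \<in> carrier A" "y \<in> carrier A" shows "\<parallel>x \<ominus> y\<parallel> = \<parallel>y \<ominus> x\<parallel>"
proof -
  have "y \<ominus> x = (-1) \<odot> (x \<ominus> y)"
    by (rule algebraic_identity[where xs="[x,y]" and ys="[]"], (rule represent)+) (simp_all add: assms)
  then show ?thesis using assms by (simp add: norm_neg)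
qed

lemma norm_triangle_minus:
  assumes "x \<in> carrier A" "y \<in> carrier A" "z \<in> carrier A"
  shows "\<parallel>x \<ominus> z\<parallel> \<le> \<parallel>x \<ominus> y\<parallel> + \<parallel>y \<ominus> z\<parallel>"
proof -
  have "x \<ominus> z = (x \<ominus> y) \<oplus> (y \<ominus> z)"
    by (rule algebraic_identity[where xs="[x,y,z]" and ys="[]"], (rule represent)+) (simp_all add: assms)
  then show ?thesis using norm_triangle[of "x \<ominus> y" "y \<ominus> z"] assms by simp
qed

lemma norm_le_norm_minus:
  assumes "x \<in> carrier A" "y \<in> carrier A" shows "\<parallel>x\<parallel> \<le> \<parallel>y\<parallel> + \<parallel>x \<ominus> y\<parallel>"
proof -
  have "x = y \<oplus> (x \<ominus> y)"
    by (rule algebraic_identity[where xs="[x,y]" and ys="[]"], (rule represent)+) (simp_all add: assms)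
  then show ?thesis using norm_triangle[of y "x \<ominus> y"] assms by simp
qed

lemma eq_if_norm_minus_tendsto_0:
  assumes "x \<in> carrier A" "y \<in> carrier A" "f \<longlonglongrightarrow> 0" "\<And>n. \<parallel>x \<ominus> y\<parallel> \<le> f n"
  shows "x = y"
proof -
  have "\<parallel>x \<ominus> y\<parallel> \<le> 0" by (rule LIMSEQ_le_const[OF assms(3)]) (use assms(4) in blast)
  then have "\<parallel>x \<ominus> y\<parallel> = 0" using norm_nonneg[of "x \<ominus> y"] assms by simp
  then show ?thesis using assms by (simp add: norm_eq_zero minus_eq_zero_iff)
qed

text \<open>Majorant principle: the increments are dominated by those of a bounded increasing real
  sequence, so they telescope to a Cauchy estimate. No geometric rate is required, which matters for
  the square root iteration at norm 1.\<close>

lemma dominated_sequence_converges: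
  fixes t :: "nat \<Rightarrow> real"
  assumes s: "\<And>n. s n \<in> carrier A" and d: "\<And>n. \<parallel>s (Suc n) \<ominus> s n\<parallel> \<le> t (Suc n) - t n"
    and C: "\<And>n. t n \<le> C"
  obtains x where "x \<in> carrier A" "(\<lambda>n. \<parallel>s n \<ominus> x\<parallel>) \<longlonglongrightarrow> 0"
proof -
  have inc: "incseq t"
    using d norm_nonneg s by (intro incseq_SucI) (smt (verit) closed)
  obtain L where L: "t \<longlonglongrightarrow> L" "\<And>n. t n \<le> L"
    using incseq_convergent[OF inc, of C] C by auto
  have dist: "\<parallel>s (n + k) \<ominus> s n\<parallel> \<le> t (n + k) - t n" for n k
  proof (induction k)
    case 0 then show ?case using s by simp
  next
    case (Suc k)
    then show ?case
      using norm_triangle_minus[of "s (Suc (n + k))" "s (n + k)" "s n"] d[of "n + k"] s by simp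
  qed
  have "\<exists>N. \<forall>m\<ge>N. \<forall>n\<ge>N. \<parallel>s m \<ominus> s n\<parallel> < e" if e: "e > 0" for e
  proof -
    obtain N where "\<forall>n\<ge>N. norm (t n - L) < e / 2"
      using LIMSEQ_D[OF L(1) half_gt_zero[OF e]] by blast
    then have "norm (t N - L) < e / 2" by simp
    then have N: "L - t N < e / 2" unfolding real_norm_def by linarith
    have "\<parallel>s m \<ominus> s N\<parallel> < e / 2" if "m \<ge> N" for m
      using dist[of N "m - N"] L(2)[of m] N that by simp
    then have "\<parallel>s m \<ominus> s n\<parallel> < e" if "m \<ge> N" "n \<ge> N" for m n
      using norm_triangle_minus[of "s m" "s N" "s n"] norm_minus_commute[of "s n" "s N"] s that
      by (smt (verit) field_sum_of_halves)
    then show ?thesis by blast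
  qed
  then show ?thesis using complete[of s] s that by blast
qed

definition invertible :: "'a \<Rightarrow> bool" where
  "invertible x \<longleftrightarrow> (\<exists>y\<in>carrier A. x \<otimes> y = \<one> \<and> y \<otimes> x = \<one>)"

text \<open>Neumann series in Horner form: \<open>s n\<close> is the sum of the first
  \<open>n\<close> powers of \<open>x\<close>, starting with \<one>, and \<open>t n\<close> is the
  corresponding geometric sum of norms. The limit solves
  \<open>\<one> \<oplus> x \<otimes> y = y\<close>, and since the partial sums commute with
  \<open>x\<close>, it is a two-sided inverse.\<close>

lemma invertible_one_minus:
  assumes x: "x \<in> carrier A" and less: "\<parallel>x\<parallel> < 1"
  shows "invertible (\<one> \<ominus> x)"
proof -
  define s where "s = rec_nat \<zero> (\<lambda>_ y. \<one> \<oplus> x \<otimes> y)"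
  define t where "t = rec_nat (0::real) (\<lambda>_ u. 1 + \<parallel>x\<parallel> * u)"
  have s_simps: "s 0 = \<zero>" "s (Suc n) = \<one> \<oplus> x \<otimes> s n" for n by (simp_all add: s_def)
  have t_simps: "t 0 = 0" "t (Suc n) = 1 + \<parallel>x\<parallel> * t n" for n by (simp_all add: t_def)
  have s: "s n \<in> carrier A" for n by (induction n) (simp_all add: s_simps x)
  have comm: "s n \<otimes> x = x \<otimes> s n" for n
    by (induction n) (simp_all add: s_simps x s distrib_left distrib_right mult_assoc)
  have C: "t n \<le> 1 / (1 - \<parallel>x\<parallel>)" for n
  proof (induction n)
    case (Suc n)
    have "1 + \<parallel>x\<parallel> * t n \<le> 1 + \<parallel>x\<parallel> * (1 / (1 - \<parallel>x\<parallel>))"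
      using Suc norm_nonneg[OF x] by (intro add_left_mono mult_left_mono)
    also have "\<dots> = 1 / (1 - \<parallel>x\<parallel>)" using less by (simp add: field_simps)
    finally show ?case by (simp add: t_simps)
  qed (use less t_simps in simp)
  have d: "\<parallel>s (Suc n) \<ominus> s n\<parallel> \<le> t (Suc n) - t n" for n
  proof (induction n)
    case 0
    have "\<one> \<ominus> \<zero> = \<one>"
      by (rule algebraic_identity[where xs="[]" and ys="[]"], (rule represent)+) simp_all
    then show ?case using norm_one_le by (simp add: s_simps t_simps x)
  next
    case (Suc n)
    have "s (Suc (Suc n)) \<ominus> s (Suc n) = x \<otimes> (s (Suc n) \<ominus> s n)"
      unfolding s_simps
      by (rule algebraic_identity[where xs="[x,s n]" and ys="[]"], (rule represent)+) (simp_all add: x s)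
    also have "\<parallel>\<dots>\<parallel> \<le> \<parallel>x\<parallel> * \<parallel>s (Suc n) \<ominus> s n\<parallel>" using norm_mult x s by simp
    also have "\<dots> \<le> \<parallel>x\<parallel> * (t (Suc n) - t n)" using Suc norm_nonneg[OF x] by (simp add: mult_left_mono)
    also have "\<dots> = t (Suc (Suc n)) - t (Suc n)" by (simp add: t_simps algebra_simps)
    finally show ?case .
  qed
  obtain y where y: "y \<in> carrier A" and lim: "(\<lambda>n. \<parallel>s n \<ominus> y\<parallel>) \<longlonglongrightarrow> 0"
    using dominated_sequence_converges[of s t, OF s d C] by blast
  note limSuc = LIMSEQ_Suc[OF lim]
  have 1: "\<one> \<oplus> x \<otimes> y = y"
  proof (rule eq_if_norm_minus_tendsto_0)
    show "(\<lambda>n. \<parallel>x\<parallel> * \<parallel>s n \<ominus> y\<parallel> + \<parallel>s (Suc n) \<ominus> y\<parallel>) \<longlonglongrightarrow> 0"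
      using tendsto_add[OF tendsto_mult_right_zero[OF lim] limSuc] by simp
    fix n
    have "(\<one> \<oplus> x \<otimes> y) \<ominus> s (Suc n) = x \<otimes> (y \<ominus> s n)"
      unfolding s_simps
      by (rule algebraic_identity[where xs="[x,y,s n]" and ys="[]"], (rule represent)+) (simp_all add: x s y)
    also have "\<parallel>\<dots>\<parallel> \<le> \<parallel>x\<parallel> * \<parallel>s n \<ominus> y\<parallel>"
      using norm_mult[of x "y \<ominus> s n"] norm_minus_commute[of y "s n"] x s y by simp
    finally show "\<parallel>(\<one> \<oplus> x \<otimes> y) \<ominus> y\<parallel> \<le> \<parallel>x\<parallel> * \<parallel>s n \<ominus> y\<parallel> + \<parallel>s (Suc n) \<ominus> y\<parallel>"
      using norm_triangle_minus[of "\<one> \<oplus> x \<otimes> y" "s (Suc n)" y] x y s by simp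
  qed (use x y in simp_all)
  have 2: "y \<otimes> x = x \<otimes> y"
  proof (rule eq_if_norm_minus_tendsto_0)
    show "(\<lambda>n. 2 * \<parallel>x\<parallel> * \<parallel>s n \<ominus> y\<parallel>) \<longlonglongrightarrow> 0"
      using tendsto_mult_right_zero[OF lim] by simp
    fix n
    have "(y \<otimes> x) \<ominus> (x \<otimes> y) = (y \<ominus> s n) \<otimes> x \<oplus> x \<otimes> (s n \<ominus> y) \<oplus> (s n \<otimes> x \<ominus> x \<otimes> s n)"
      by (rule algebraic_identity[where xs="[x,y,s n]" and ys="[]"], (rule represent)+) (simp_all add: x s y)
    also have "\<dots> = (y \<ominus> s n) \<otimes> x \<oplus> x \<otimes> (s n \<ominus> y)" using x y s comm by simp
    also have "\<parallel>\<dots>\<parallel> \<le> \<parallel>y \<ominus> s n\<parallel> * \<parallel>x\<parallel> + \<parallel>x\<parallel> * \<parallel>s n \<ominus> y\<parallel>"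
      using norm_triangle[of "(y \<ominus> s n) \<otimes> x" "x \<otimes> (s n \<ominus> y)"] norm_mult[of "y \<ominus> s n" x]
        norm_mult[of x "s n \<ominus> y"] x s y by simp
    finally show "\<parallel>(y \<otimes> x) \<ominus> (x \<otimes> y)\<parallel> \<le> 2 * \<parallel>x\<parallel> * \<parallel>s n \<ominus> y\<parallel>"
      using norm_minus_commute[of y "s n"] y s by simp
  qed (use x y in simp_all)
  have "(\<one> \<ominus> x) \<otimes> y = (\<one> \<oplus> x \<otimes> y) \<oplus> (y \<ominus> (\<one> \<oplus> x \<otimes> y)) \<ominus> x \<otimes> y"
    by (rule algebraic_identity[where xs="[x,y]" and ys="[]"], (rule represent)+) (simp_all add: x y)
  also have "\<dots> = (\<one> \<oplus> x \<otimes> y) \<ominus> x \<otimes> y" using 1 x y by simp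
  also have "\<dots> = \<one>"
    by (rule algebraic_identity[where xs="[x,y]" and ys="[]"], (rule represent)+) (simp_all add: x y)
  finally have "(\<one> \<ominus> x) \<otimes> y = \<one>" .
  moreover have "y \<otimes> (\<one> \<ominus> x) = (\<one> \<ominus> x) \<otimes> y"
    using 2 x y by (simp add: cminus_def distrib_left distrib_right scale_mult_left scale_mult_right)
  ultimately show ?thesis using y by (auto simp: invertible_def)
qed

text \<open>Closure under the star is deliberately not demanded: the commutant of an arbitrary
  element and the set of left multipliers of \<open>B\<close> must both qualify.\<close>

definition closed_unital_subalgebra :: "'a set \<Rightarrow> bool" where
  "closed_unital_subalgebra T \<longleftrightarrow> norm_closed_in A T \<and> \<one> \<in> T \<and>
     (\<forall>x\<in>T. \<forall>y\<in>T. x \<oplus> y \<in> T \<and> x \<otimes> y \<in> T) \<and> (\<forall>x\<in>T. \<forall>c. c \<odot> x \<in> T)"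

lemma closed_unital_subalgebra_minus:
  "closed_unital_subalgebra T \<Longrightarrow> x \<in> T \<Longrightarrow> y \<in> T \<Longrightarrow> x \<ominus> y \<in> T"
  by (simp add: closed_unital_subalgebra_def cminus_def)

text \<open>The limit \<open>y\<close> of the iteration \<open>(x + f\<^sup>2) / 2\<close> satisfies
  \<open>2y = x + y\<^sup>2\<close>, that is \<open>(1 - y)\<^sup>2 = 1 - x\<close>, so
  \<open>s = 1 - y\<close>. The majorant is the same recursion for the scalar 1 in place of
  \<open>x\<close>; it increases and stays below 1. The bound on \<open>\<one> \<ominus> s\<close>
  serves as positivity of \<open>s\<close>, and the last clause holds because every iterate is a
  polynomial in \<open>x\<close>.\<close>

lemma sqrt_one_minus:
  assumes x: "x \<in> carrier A" and xs: "x\<^sup>\<star> = x" and le: "\<parallel>x\<parallel> \<le> 1"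
  obtains s where "s \<in> carrier A" "s\<^sup>\<star> = s" "s \<otimes> s = \<one> \<ominus> x" "\<parallel>\<one> \<ominus> s\<parallel> \<le> 1"
    "\<And>T. closed_unital_subalgebra T \<Longrightarrow> x \<in> T \<Longrightarrow> s \<in> T"
proof -
  define f where "f = rec_nat \<zero> (\<lambda>_ y. (1/2) \<odot> (x \<oplus> y \<otimes> y))"
  define t where "t = rec_nat (0::real) (\<lambda>_ u. (1 + u\<^sup>2) / 2)"
  have f_simps: "f 0 = \<zero>" "f (Suc n) = (1/2) \<odot> (x \<oplus> f n \<otimes> f n)" for n by (simp_all add: f_def)
  have t_simps: "t 0 = 0" "t (Suc n) = (1 + (t n)\<^sup>2) / 2" for n by (simp_all add: t_def)
  have f: "f n \<in> carrier A" for n by (induction n) (simp_all add: f_simps x)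
  have fs: "(f n)\<^sup>\<star> = f n" for n by (induction n) (simp_all add: f_simps x xs f star_scale star_add star_mult)
  have fx: "f n \<otimes> x = x \<otimes> f n" for n
    by (induction n) (simp_all add: f_simps x f scale_mult_left scale_mult_right distrib_left
        distrib_right mult_assoc, simp flip: mult_assoc add: x f)
  have t01: "0 \<le> t n \<and> t n \<le> 1" for n
    by (induction n) (auto simp: t_simps power_le_one)
  have fle: "\<parallel>f n\<parallel> \<le> t n" for n
  proof (induction n)
    case (Suc n)
    have "\<parallel>f (Suc n)\<parallel> \<le> (1/2) * (\<parallel>x\<parallel> + \<parallel>f n \<otimes> f n\<parallel>)"
      using norm_triangle[of x "f n \<otimes> f n"] x f by (simp add: f_simps norm_scale)
    also have "\<parallel>f n \<otimes> f n\<parallel> = \<parallel>f n\<parallel>\<^sup>2" using f fs by (simp add: norm_square)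
    also have "(1/2) * (\<parallel>x\<parallel> + \<parallel>f n\<parallel>\<^sup>2) \<le> (1/2) * (1 + (t n)\<^sup>2)"
      using Suc le norm_nonneg[OF f] by (intro mult_left_mono add_mono power_mono) auto
    finally show ?case by (simp add: t_simps)
  qed (simp add: f_simps t_simps)
  have comm: "f (Suc n) \<otimes> f n = f n \<otimes> f (Suc n)" for n
    using fx[of n] by (simp add: f_simps x f scale_mult_left scale_mult_right distrib_left
        distrib_right mult_assoc)
  have d: "\<parallel>f (Suc n) \<ominus> f n\<parallel> \<le> t (Suc n) - t n" for n
  proof (induction n)
    case 0
    have "f (Suc 0) \<ominus> f 0 = f (Suc 0)"
      by (rule algebraic_identity[where xs="[f (Suc 0)]" and ys="[]"], unfold f_simps(1), (rule represent)+) (simp_all add: f)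
    then show ?case using fle[of "Suc 0"] by (simp add: t_simps)
  next
    case (Suc n)
    let ?g = "f (Suc n)" and ?h = "f n"
    have "f (Suc (Suc n)) \<ominus> f (Suc n)
        = (1/2) \<odot> (x \<oplus> ?g \<otimes> ?g) \<ominus> (1/2) \<odot> (x \<oplus> ?h \<otimes> ?h)"
      using f_simps by metis
    \<comment> \<open>A difference of squares factors up to a commutator, which vanishes because
      consecutive iterates commute.\<close>
    also have "\<dots> = (1/2) \<odot> ((?g \<oplus> ?h) \<otimes> (?g \<ominus> ?h) \<oplus> (?g \<otimes> ?h \<ominus> ?h \<otimes> ?g))"
      by (rule algebraic_identity[where xs="[x,?g,?h]" and ys="[]"], (rule represent)+) (simp_all add: x f)
    also have "\<dots> = (1/2) \<odot> ((?g \<oplus> ?h) \<otimes> (?g \<ominus> ?h))" using f comm by simp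
    also have "\<parallel>\<dots>\<parallel> \<le> (1/2) * (\<parallel>?g \<oplus> ?h\<parallel> * \<parallel>?g \<ominus> ?h\<parallel>)"
      using norm_mult f by (simp add: norm_scale)
    also have "\<dots> \<le> (1/2) * ((t (Suc n) + t n) * (t (Suc n) - t n))"
      using norm_triangle[of ?g ?h] fle[of n] fle[of "Suc n"] f t01[of n] t01[of "Suc n"] norm_nonneg Suc
      by (intro mult_left_mono mult_mono) auto
    also have "\<dots> = t (Suc (Suc n)) - t (Suc n)"
      unfolding t_simps(2)[of "Suc n"] by (subst (3) t_simps(2)) (simp add: field_simps power2_eq_square)
    finally show ?case .
  qed
  obtain y where y: "y \<in> carrier A" and lim: "(\<lambda>n. \<parallel>f n \<ominus> y\<parallel>) \<longlonglongrightarrow> 0"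
    using dominated_sequence_converges[of f t 1, OF f d] t01 by blast
  note limSuc = LIMSEQ_Suc[OF lim]
  have ys: "y\<^sup>\<star> = y"
  proof (rule eq_if_norm_minus_tendsto_0)
    show "(\<lambda>n. 2 * \<parallel>f n \<ominus> y\<parallel>) \<longlonglongrightarrow> 0" using tendsto_mult_right_zero[OF lim] by simp
    fix n
    have "(f n \<ominus> y)\<^sup>\<star> = f n \<ominus> y\<^sup>\<star>"
      by (rule algebraic_identity[where xs="[y]" and ys="[f n]"], (rule represent)+) (simp_all add: fs f y)
    then have "\<parallel>y\<^sup>\<star> \<ominus> f n\<parallel> = \<parallel>f n \<ominus> y\<parallel>"
      using norm_star[of "f n \<ominus> y"] norm_minus_commute[of "y\<^sup>\<star>" "f n"] f y by simp
    then show "\<parallel>y\<^sup>\<star> \<ominus> y\<parallel> \<le> 2 * \<parallel>f n \<ominus> y\<parallel>"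
      using norm_triangle_minus[of "y\<^sup>\<star>" "f n" y] f y by simp
  qed (use y in simp_all)
  have yle: "\<parallel>y\<parallel> \<le> 1"
  proof (rule LIMSEQ_le_const)
    show "(\<lambda>n. 1 + \<parallel>f n \<ominus> y\<parallel>) \<longlonglongrightarrow> 1" using tendsto_add[OF tendsto_const lim, of 1] by simp
    have "\<parallel>y\<parallel> \<le> 1 + \<parallel>f n \<ominus> y\<parallel>" for n
      using norm_le_norm_minus[OF y f[of n]] norm_minus_commute[OF y f[of n]] fle[of n] t01[of n] by simp
    then show "\<exists>N. \<forall>n\<ge>N. \<parallel>y\<parallel> \<le> 1 + \<parallel>f n \<ominus> y\<parallel>" by blast
  qed
  have yeq: "(1/2) \<odot> (x \<oplus> y \<otimes> y) = y"
  proof (rule eq_if_norm_minus_tendsto_0)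
    show "(\<lambda>n. \<parallel>f n \<ominus> y\<parallel> + \<parallel>f (Suc n) \<ominus> y\<parallel>) \<longlonglongrightarrow> 0"
      using tendsto_add[OF lim limSuc] by simp
    fix n
    let ?h = "f n"
    have "(1/2) \<odot> (x \<oplus> y \<otimes> y) \<ominus> f (Suc n) = (1/2) \<odot> (y \<otimes> (y \<ominus> ?h) \<oplus> (y \<ominus> ?h) \<otimes> ?h)"
      unfolding f_simps
      by (rule algebraic_identity[where xs="[x,?h,y]" and ys="[]"], (rule represent)+) (simp_all add: x y f)
    also have "\<parallel>\<dots>\<parallel> \<le> (1/2) * (\<parallel>y\<parallel> * \<parallel>y \<ominus> ?h\<parallel> + \<parallel>y \<ominus> ?h\<parallel> * \<parallel>?h\<parallel>)"
      using norm_triangle[of "y \<otimes> (y \<ominus> ?h)" "(y \<ominus> ?h) \<otimes> ?h"] norm_mult[of y "y \<ominus> ?h"]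
        norm_mult[of "y \<ominus> ?h" ?h] y f by (simp add: norm_scale)
    also have "\<dots> \<le> (1/2) * (1 * \<parallel>y \<ominus> ?h\<parallel> + \<parallel>y \<ominus> ?h\<parallel> * 1)"
      using yle fle[of n] t01[of n] y f norm_nonneg[of "y \<ominus> ?h"]
      by (intro mult_left_mono add_mono mult_right_mono) auto
    also have "\<dots> = \<parallel>?h \<ominus> y\<parallel>" using norm_minus_commute[OF y f] by simp
    finally show "\<parallel>(1/2) \<odot> (x \<oplus> y \<otimes> y) \<ominus> y\<parallel> \<le> \<parallel>?h \<ominus> y\<parallel> + \<parallel>f (Suc n) \<ominus> y\<parallel>"
      using norm_triangle_minus[of "(1/2) \<odot> (x \<oplus> y \<otimes> y)" "f (Suc n)" y] x y f by simp
  qed (use x y in simp_all)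
  have "(\<one> \<ominus> y) \<otimes> (\<one> \<ominus> y) = \<one> \<ominus> x \<oplus> 2 \<odot> ((1/2) \<odot> (x \<oplus> y \<otimes> y) \<ominus> y)"
    by (rule algebraic_identity[where xs="[x,y]" and ys="[]"], (rule represent)+) (simp_all add: x y)
  then have sq: "(\<one> \<ominus> y) \<otimes> (\<one> \<ominus> y) = \<one> \<ominus> x" using yeq x y by simp
  have yT: "y \<in> T" if T: "closed_unital_subalgebra T" and xT: "x \<in> T" for T
  proof -
    have "f n \<in> T" for n
    proof (induction n)
      case 0
      have "0 \<odot> \<one> \<in> T" using T unfolding closed_unital_subalgebra_def by blast
      then show ?case by (simp add: f_simps)
    next
      case (Suc n) then show ?case using T xT by (simp add: f_simps closed_unital_subalgebra_def)
    qed
    then show ?thesis using T lim y unfolding closed_unital_subalgebra_def norm_closed_in_def by blast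
  qed
  show ?thesis
  proof (rule that[of "\<one> \<ominus> y"])
    show "(\<one> \<ominus> y)\<^sup>\<star> = \<one> \<ominus> y"
      by (rule algebraic_identity[where xs="[]" and ys="[y]"], (rule represent)+) (simp_all add: y ys)
    have "\<one> \<ominus> (\<one> \<ominus> y) = y"
      by (rule algebraic_identity[where xs="[y]" and ys="[]"], (rule represent)+) (simp_all add: y)
    then show "\<parallel>\<one> \<ominus> (\<one> \<ominus> y)\<parallel> \<le> 1" using yle by simp
    show "\<one> \<ominus> y \<in> T" if "closed_unital_subalgebra T" "x \<in> T" for T
      using that yT closed_unital_subalgebra_minus closed_unital_subalgebra_def by metis
  qed (use sq y in simp_all)
qed

lemma closed_unital_subalgebra_commutant:
  assumes z: "z \<in> carrier A"
  shows "closed_unital_subalgebra {y \<in> carrier A. y \<otimes> z = z \<otimes> y}"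
proof -
  have "x \<otimes> z = z \<otimes> x"
    if s: "\<And>n. s n \<in> carrier A \<and> s n \<otimes> z = z \<otimes> s n" and x: "x \<in> carrier A"
      and lim: "(\<lambda>n. \<parallel>s n \<ominus> x\<parallel>) \<longlonglongrightarrow> 0" for s :: "nat \<Rightarrow> 'a" and x
  proof (rule eq_if_norm_minus_tendsto_0)
    show "(\<lambda>n. 2 * \<parallel>z\<parallel> * \<parallel>s n \<ominus> x\<parallel>) \<longlonglongrightarrow> 0" using tendsto_mult_right_zero[OF lim] by simp
    fix n
    have sn: "s n \<in> carrier A" "s n \<otimes> z = z \<otimes> s n" using s by auto
    have "(x \<otimes> z) \<ominus> (z \<otimes> x) = (x \<ominus> s n) \<otimes> z \<oplus> z \<otimes> (s n \<ominus> x) \<oplus> (s n \<otimes> z \<ominus> z \<otimes> s n)"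
      by (rule algebraic_identity[where xs="[x,z,s n]" and ys="[]"], (rule represent)+) (simp_all add: x sn(1) z)
    also have "\<dots> = (x \<ominus> s n) \<otimes> z \<oplus> z \<otimes> (s n \<ominus> x)" using x z sn by simp
    also have "\<parallel>\<dots>\<parallel> \<le> \<parallel>x \<ominus> s n\<parallel> * \<parallel>z\<parallel> + \<parallel>z\<parallel> * \<parallel>s n \<ominus> x\<parallel>"
      using norm_triangle[of "(x \<ominus> s n) \<otimes> z" "z \<otimes> (s n \<ominus> x)"] norm_mult[of "x \<ominus> s n" z]
        norm_mult[of z "s n \<ominus> x"] x sn(1) z by simp
    finally show "\<parallel>(x \<otimes> z) \<ominus> (z \<otimes> x)\<parallel> \<le> 2 * \<parallel>z\<parallel> * \<parallel>s n \<ominus> x\<parallel>"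
      using norm_minus_commute[of x "s n"] x sn(1) by simp
  qed (use x z in simp_all)
  then show ?thesis using z
    by (auto simp: closed_unital_subalgebra_def norm_closed_in_def distrib_left distrib_right
        scale_mult_left scale_mult_right mult_assoc) (simp flip: mult_assoc)
qed

text \<open>A small double commutant argument: the commutant of \<open>z\<close> is itself one of
  the closed unital subalgebras that contain \<open>x\<close>.\<close>

lemma commute_of_closed_unital_subalgebra:
  assumes "\<And>T. closed_unital_subalgebra T \<Longrightarrow> x \<in> T \<Longrightarrow> s \<in> T"
    and "x \<in> carrier A" "z \<in> carrier A" "x \<otimes> z = z \<otimes> x"
  shows "s \<otimes> z = z \<otimes> s"
  using assms(1)[OF closed_unital_subalgebra_commutant[OF assms(3)]] assms by blast

text \<open>The norm bound is the form of \<open>0 \<le> x \<le> 2M\<close> that needs no order.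
  Division by \<open>M\<close> reduces to a root of \<open>\<one> \<ominus> z\<close>; for
  \<open>M = 0\<close> the bound forces \<open>x = \<zero>\<close>. The root satisfies a bound of
  the same shape, so it can be rooted again.\<close>

lemma sqrt_near_scalar:
  assumes x: "x \<in> carrier A" and xs: "x\<^sup>\<star> = x" and M: "0 \<le> M"
    and le: "\<parallel>of_real M \<odot> \<one> \<ominus> x\<parallel> \<le> M"
  obtains s where "s \<in> carrier A" "s\<^sup>\<star> = s" "s \<otimes> s = x" "\<parallel>of_real (sqrt M) \<odot> \<one> \<ominus> s\<parallel> \<le> sqrt M"
    "\<And>T. closed_unital_subalgebra T \<Longrightarrow> x \<in> T \<Longrightarrow> s \<in> T"
proof (cases "M = 0")
  case True
  have "\<zero> \<ominus> x = \<zero>"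
    using le norm_nonneg[of "\<zero> \<ominus> x"] norm_eq_zero[of "\<zero> \<ominus> x"] x by (simp add: True)
  then have "x = \<zero>" using minus_eq_zero_iff[of "\<zero>" x] x by simp
  then show ?thesis using True that[of "\<zero>"] by simp
next
  case False
  then have pos: "M > 0" using M by simp
  define z where "z = of_real (1 / M) \<odot> (of_real M \<odot> \<one> \<ominus> x)"
  have z: "z \<in> carrier A" "z\<^sup>\<star> = z"
  proof -
    show "z\<^sup>\<star> = z" unfolding z_def
      by (rule algebraic_identity[where xs="[]" and ys="[x]"], (rule represent)+) (simp_all add: x xs)
  qed (simp add: z_def x)
  have "\<parallel>z\<parallel> \<le> 1" using le pos x by (simp add: z_def norm_scale norm_divide)
  then obtain s where s: "s \<in> carrier A" "s\<^sup>\<star> = s" "s \<otimes> s = \<one> \<ominus> z" "\<parallel>\<one> \<ominus> s\<parallel> \<le> 1"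
    "\<And>T. closed_unital_subalgebra T \<Longrightarrow> z \<in> T \<Longrightarrow> s \<in> T"
    using sqrt_one_minus z by metis
  show ?thesis
  proof (rule that[of "of_real (sqrt M) \<odot> s"])
    have "(of_real (sqrt M) \<odot> s) \<otimes> (of_real (sqrt M) \<odot> s) = of_real M \<odot> (s \<otimes> s)"
      using s(1) pos by (simp add: scale_mult_left scale_mult_right scale_scale flip: of_real_mult)
    also have "\<dots> = of_real M \<odot> (\<one> \<ominus> z)" using s(3) by simp
    also have "\<dots> = x" unfolding z_def
      by (rule algebraic_identity[where xs="[x]" and ys="[]"], (rule represent)+) (use pos in \<open>simp_all add: x\<close>)
    finally show "(of_real (sqrt M) \<odot> s) \<otimes> (of_real (sqrt M) \<odot> s) = x" .
    have "of_real (sqrt M) \<odot> \<one> \<ominus> of_real (sqrt M) \<odot> s = of_real (sqrt M) \<odot> (\<one> \<ominus> s)"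
      by (rule algebraic_identity[where xs="[s]" and ys="[]"], (rule represent)+) (simp_all add: s(1))
    then show "\<parallel>of_real (sqrt M) \<odot> \<one> \<ominus> of_real (sqrt M) \<odot> s\<parallel> \<le> sqrt M"
      using s(1,4) pos by (simp add: norm_scale mult_left_le)
    fix T assume T: "closed_unital_subalgebra T" "x \<in> T"
    then have "z \<in> T"
      unfolding z_def using closed_unital_subalgebra_minus[OF T(1)]
      by (simp add: closed_unital_subalgebra_def)
    then show "of_real (sqrt M) \<odot> s \<in> T" using s(5) T by (simp add: closed_unital_subalgebra_def)
  qed (use s in \<open>simp_all add: star_scale\<close>)
qed

section \<open>Positivity\<close>

text \<open>Arens' trick: \<open>u + iv\<close> is normal, so its norm is at least that of its real part.\<close>

lemma norm_square_le_sum_of_commuting_squares: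
  assumes u: "u \<in> carrier A" "u\<^sup>\<star> = u" and v: "v \<in> carrier A" "v\<^sup>\<star> = v"
    and comm: "u \<otimes> v = v \<otimes> u"
  shows "\<parallel>u \<otimes> u\<parallel> \<le> \<parallel>u \<otimes> u \<oplus> v \<otimes> v\<parallel>"
proof -
  let ?w = "u \<oplus> \<i> \<odot> v"
  have "u = (1/2) \<odot> (?w \<oplus> ?w\<^sup>\<star>)"
    by (rule algebraic_identity[where xs="[]" and ys="[u,v]"], (rule represent)+) (simp_all add: u v)
  then have "\<parallel>u\<parallel> = (1/2) * \<parallel>?w \<oplus> ?w\<^sup>\<star>\<parallel>"
    using norm_scale[of "?w \<oplus> ?w\<^sup>\<star>" "1/2"] u v by simp
  also have "\<dots> \<le> \<parallel>?w\<parallel>"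
    using norm_triangle[of ?w "?w\<^sup>\<star>"] norm_star[of ?w] u v by simp
  finally have "\<parallel>u\<parallel>\<^sup>2 \<le> \<parallel>?w\<parallel>\<^sup>2" using norm_nonneg[OF u(1)] by simp
  also have "\<dots> = \<parallel>?w\<^sup>\<star> \<otimes> ?w\<parallel>" using cstar_identity[of ?w] u v by simp
  also have "?w\<^sup>\<star> \<otimes> ?w = u \<otimes> u \<oplus> v \<otimes> v \<oplus> \<i> \<odot> (u \<otimes> v \<ominus> v \<otimes> u)"
    by (rule algebraic_identity[where xs="[]" and ys="[u,v]"], (rule represent)+) (simp_all add: u v)
  finally show ?thesis using norm_square[OF u] comm u v by simp
qed

section \<open>The cone of squares of self-adjoint elements\<close>

definition herm_square :: "'a \<Rightarrow> bool" where
  "herm_square x \<longleftrightarrow> (\<exists>s\<in>carrier A. s\<^sup>\<star> = s \<and> x = s \<otimes> s)"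

lemma herm_squareE:
  assumes "herm_square x" obtains s where "s \<in> carrier A" "s\<^sup>\<star> = s" "x = s \<otimes> s"
  using assms by (auto simp: herm_square_def)

lemma herm_squareI: "s \<in> carrier A \<Longrightarrow> s\<^sup>\<star> = s \<Longrightarrow> herm_square (s \<otimes> s)"
  by (auto simp: herm_square_def)

lemma herm_square_closed: "herm_square x \<Longrightarrow> x \<in> carrier A"
  and herm_square_star: "herm_square x \<Longrightarrow> x\<^sup>\<star> = x"
  by (auto simp: herm_square_def star_mult)

lemma herm_square_near_scalar:
  "x \<in> carrier A \<Longrightarrow> x\<^sup>\<star> = x \<Longrightarrow> 0 \<le> M \<Longrightarrow> \<parallel>of_real M \<odot> \<one> \<ominus> x\<parallel> \<le> M \<Longrightarrow> herm_square x"
  using sqrt_near_scalar herm_squareI by metis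

lemma scalar_minus_minus:
  "x \<in> carrier A \<Longrightarrow> c \<odot> \<one> \<ominus> (c \<odot> \<one> \<ominus> x) = x"
  by (rule algebraic_identity[where xs="[x]" and ys="[]"], (rule represent)+) simp_all

lemma scalar_minus_star:
  "x \<in> carrier A \<Longrightarrow> x\<^sup>\<star> = x \<Longrightarrow> (of_real M \<odot> \<one> \<ominus> x)\<^sup>\<star> = of_real M \<odot> \<one> \<ominus> x"
  by (rule algebraic_identity[where xs="[]" and ys="[x]"], (rule represent)+) simp_all

lemma herm_square_scalar_minus:
  "x \<in> carrier A \<Longrightarrow> x\<^sup>\<star> = x \<Longrightarrow> \<parallel>x\<parallel> \<le> M \<Longrightarrow> herm_square (of_real M \<odot> \<one> \<ominus> x)"
  using norm_nonneg[of x]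
  by (intro herm_square_near_scalar[where M=M]) (simp_all add: scalar_minus_star scalar_minus_minus)

lemma norm_scalar_le: "0 \<le> M \<Longrightarrow> \<parallel>of_real M \<odot> \<one>\<parallel> \<le> M"
  using norm_one_le by (simp add: norm_scale mult_left_le)

text \<open>This turns a square back into the norm criterion. As
  \<open>M - (M - u\<^sup>2) = u\<^sup>2\<close> has norm at most \<open>M\<close>, the element
  \<open>M - u\<^sup>2\<close> has a root \<open>s\<close>; it commutes with \<open>u\<close>, so
  Arens' inequality bounds \<open>s\<^sup>2\<close> by
  \<open>s\<^sup>2 + u\<^sup>2 = M\<close>.\<close>

lemma norm_scalar_minus_square:
  assumes u: "u \<in> carrier A" "u\<^sup>\<star> = u" and le: "\<parallel>u \<otimes> u\<parallel> \<le> M"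
  shows "\<parallel>of_real M \<odot> \<one> \<ominus> u \<otimes> u\<parallel> \<le> M"
proof -
  let ?x = "of_real M \<odot> \<one> \<ominus> u \<otimes> u"
  have M: "0 \<le> M" using le norm_nonneg[of "u \<otimes> u"] u by simp
  have x: "?x \<in> carrier A" "?x\<^sup>\<star> = ?x" using u by (simp_all add: scalar_minus_star star_mult)
  have xu: "?x \<otimes> u = u \<otimes> ?x"
    by (rule algebraic_identity[where xs="[]" and ys="[u]"], (rule represent)+) (simp_all add: u)
  obtain s where s: "s \<in> carrier A" "s\<^sup>\<star> = s" "s \<otimes> s = ?x"
    "\<And>T. closed_unital_subalgebra T \<Longrightarrow> ?x \<in> T \<Longrightarrow> s \<in> T"
    using sqrt_near_scalar[OF x M] le u scalar_minus_minus[of "u \<otimes> u"] by (metis closed)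
  have "s \<otimes> u = u \<otimes> s" using commute_of_closed_unital_subalgebra[OF s(4) x(1) u(1) xu] .
  then have "\<parallel>?x\<parallel> \<le> \<parallel>?x \<oplus> u \<otimes> u\<parallel>"
    using norm_square_le_sum_of_commuting_squares[OF s(1,2) u] s(3) by simp
  also have "?x \<oplus> u \<otimes> u = of_real M \<odot> \<one>"
    by (rule algebraic_identity[where xs="[]" and ys="[u]"], (rule represent)+) (simp_all add: u)
  finally show ?thesis using norm_scalar_le[OF M] by simp
qed

lemma herm_square_norm_scalar_minus:
  "herm_square x \<Longrightarrow> \<parallel>x\<parallel> \<le> M \<Longrightarrow> \<parallel>of_real M \<odot> \<one> \<ominus> x\<parallel> \<le> M"
  by (auto simp: norm_scalar_minus_square elim: herm_squareE)

text \<open>The witness in \<open>herm_square\<close> is arbitrary and need not commute with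
  anything but the square. It is replaced here by the positive root, which is a limit of polynomials
  in \<open>x\<close>.\<close>

lemma herm_square_sqrt:
  assumes "herm_square x"
  obtains q where "q \<in> carrier A" "q\<^sup>\<star> = q" "q \<otimes> q = x" "herm_square q"
    "\<And>T. closed_unital_subalgebra T \<Longrightarrow> x \<in> T \<Longrightarrow> q \<in> T"
proof -
  note x = herm_square_closed[OF assms] herm_square_star[OF assms]
  obtain q where q: "q \<in> carrier A" "q\<^sup>\<star> = q" "q \<otimes> q = x"
    "\<parallel>of_real (sqrt \<parallel>x\<parallel>) \<odot> \<one> \<ominus> q\<parallel> \<le> sqrt \<parallel>x\<parallel>"
    "\<And>T. closed_unital_subalgebra T \<Longrightarrow> x \<in> T \<Longrightarrow> q \<in> T"
    using sqrt_near_scalar[OF x norm_nonneg[OF x(1)] herm_square_norm_scalar_minus[OF assms order_refl]]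
    by metis
  moreover have "herm_square q"
    using herm_square_near_scalar[OF q(1,2) _ q(4)] norm_nonneg[OF x(1)] by simp
  ultimately show ?thesis using that by metis
qed

text \<open>A sum of squares is not visibly a square, but the norm criterion adds up: the centres
  \<open_placeholder> are the two norms, and the triangle inequality finishes.\<close>

lemma herm_square_add:
  assumes "herm_square x" "herm_square y" shows "herm_square (x \<oplus> y)"
proof (rule herm_square_near_scalar)
  have x: "x \<in> carrier A" "x\<^sup>\<star> = x" and y: "y \<in> carrier A" "y\<^sup>\<star> = y"
    using assms herm_square_closed herm_square_star by auto
  show "x \<oplus> y \<in> carrier A" "(x \<oplus> y)\<^sup>\<star> = x \<oplus> y" "0 \<le> \<parallel>x\<parallel> + \<parallel>y\<parallel>"
    using x y by (simp_all add: star_add norm_nonneg)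
  have "of_real (\<parallel>x\<parallel> + \<parallel>y\<parallel>) \<odot> \<one> \<ominus> (x \<oplus> y)
      = (of_real \<parallel>x\<parallel> \<odot> \<one> \<ominus> x) \<oplus> (of_real \<parallel>y\<parallel> \<odot> \<one> \<ominus> y)"
    by (rule algebraic_identity[where xs="[x,y]" and ys="[]"], (rule represent)+) (simp_all add: x y)
  then show "\<parallel>of_real (\<parallel>x\<parallel> + \<parallel>y\<parallel>) \<odot> \<one> \<ominus> (x \<oplus> y)\<parallel> \<le> \<parallel>x\<parallel> + \<parallel>y\<parallel>"
    using norm_triangle[of "of_real \<parallel>x\<parallel> \<odot> \<one> \<ominus> x" "of_real \<parallel>y\<parallel> \<odot> \<one> \<ominus> y"] x y
      herm_square_norm_scalar_minus[OF assms(1) order_refl]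
      herm_square_norm_scalar_minus[OF assms(2) order_refl] by simp
qed

lemma herm_square_scale:
  assumes "herm_square x" "0 \<le> c" shows "herm_square (of_real c \<odot> x)"
proof -
  obtain s where s: "s \<in> carrier A" "s\<^sup>\<star> = s" "x = s \<otimes> s" using assms(1) by (rule herm_squareE)
  have "of_real c \<odot> x = (of_real (sqrt c) \<odot> s) \<otimes> (of_real (sqrt c) \<odot> s)"
    using s assms(2) by (simp add: scale_mult_left scale_mult_right scale_scale flip: of_real_mult)
  then show ?thesis using s herm_squareI[of "of_real (sqrt c) \<odot> s"] by (simp add: star_scale)
qed

text \<open>The root of \<open>M - x\<close> commutes with the root \<open>u\<close> of
  \<open>x\<close>, so Arens' inequality compares \<open>x\<close> with the sum
  \<open>x + (M - x) = M\<close>.\<close>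

lemma herm_square_norm_le:
  assumes x: "herm_square x" and d: "herm_square (of_real M \<odot> \<one> \<ominus> x)" and M: "0 \<le> M"
  shows "\<parallel>x\<parallel> \<le> M"
proof -
  let ?d = "of_real M \<odot> \<one> \<ominus> x"
  obtain u where u: "u \<in> carrier A" "u\<^sup>\<star> = u" "x = u \<otimes> u" using x by (rule herm_squareE)
  obtain q where q: "q \<in> carrier A" "q\<^sup>\<star> = q" "q \<otimes> q = ?d"
    "\<And>T. closed_unital_subalgebra T \<Longrightarrow> ?d \<in> T \<Longrightarrow> q \<in> T"
    using herm_square_sqrt[OF d] by metis
  have du: "?d \<otimes> u = u \<otimes> ?d" unfolding u(3)
    by (rule algebraic_identity[where xs="[]" and ys="[u]"], (rule represent)+) (simp_all add: u)
  have "q \<otimes> u = u \<otimes> q"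
    using commute_of_closed_unital_subalgebra[OF q(4) herm_square_closed[OF d] u(1) du] .
  then have "\<parallel>x\<parallel> \<le> \<parallel>x \<oplus> ?d\<parallel>"
    using norm_square_le_sum_of_commuting_squares[OF u(1,2) q(1,2)] u(3) q(3) by simp
  also have "x \<oplus> ?d = of_real M \<odot> \<one>" unfolding u(3)
    by (rule algebraic_identity[where xs="[]" and ys="[u]"], (rule represent)+) (simp_all add: u)
  finally show ?thesis using norm_scalar_le[OF M] by simp
qed

text \<open>With \<open>M\<close> the norm of the sum, \<open>M - x = (M - (x + y)) + y\<close> is a
  sum of two squares.\<close>

lemma herm_square_norm_mono:
  assumes "herm_square x" "herm_square y" shows "\<parallel>x\<parallel> \<le> \<parallel>x \<oplus> y\<parallel>"
proof (rule herm_square_norm_le[OF assms(1)])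
  let ?M = "\<parallel>x \<oplus> y\<parallel>"
  have xy: "herm_square (x \<oplus> y)" using assms by (rule herm_square_add)
  have c: "x \<in> carrier A" "y \<in> carrier A" using assms herm_square_closed by auto
  have "of_real ?M \<odot> \<one> \<ominus> x = (of_real ?M \<odot> \<one> \<ominus> (x \<oplus> y)) \<oplus> y"
    by (rule algebraic_identity[where xs="[x,y]" and ys="[]"], (rule represent)+) (simp_all add: c)
  then show "herm_square (of_real ?M \<odot> \<one> \<ominus> x)"
    using herm_square_add[OF herm_square_scalar_minus assms(2)] xy herm_square_closed herm_square_star
    by simp
  show "0 \<le> ?M" using c by (simp add: norm_nonneg)
qed

lemma herm_square_sum_zero:
  assumes "herm_square x" "herm_square y" "x \<oplus> y = \<zero>" shows "x = \<zero>"
  using herm_square_norm_mono[OF assms(1,2)] assms(3) norm_nonneg[of x] norm_eq_zero[of x]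
    herm_square_closed[OF assms(1)] by simp

lemma square_eq_zero: "x \<in> carrier A \<Longrightarrow> x\<^sup>\<star> \<otimes> x = \<zero> \<Longrightarrow> x = \<zero>"
  using cstar_identity[of x] norm_eq_zero[of x] by simp

section \<open>Invertible elements, and the spectrum of a self-adjoint element\<close>

lemma invertible_scale:
  assumes "invertible x" "x \<in> carrier A" "c \<noteq> 0" shows "invertible (c \<odot> x)"
proof -
  obtain y where "y \<in> carrier A" "x \<otimes> y = \<one>" "y \<otimes> x = \<one>" using assms by (auto simp: invertible_def)
  then show ?thesis using assms
    by (auto simp: invertible_def scale_mult_left scale_mult_right scale_scale
        intro!: bexI[where x="(1 / c) \<odot> y"])
qed

lemma invertible_mult:
  assumes "invertible x" "invertible y" "x \<in> carrier A" "y \<in> carrier A"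
  shows "invertible (x \<otimes> y)"
proof -
  obtain v w where v: "v \<in> carrier A" "x \<otimes> v = \<one>" "v \<otimes> x = \<one>"
    and w: "w \<in> carrier A" "y \<otimes> w = \<one>" "w \<otimes> y = \<one>" using assms by (auto simp: invertible_def)
  have "(x \<otimes> y) \<otimes> (w \<otimes> v) = x \<otimes> (y \<otimes> w) \<otimes> v" "(w \<otimes> v) \<otimes> (x \<otimes> y) = w \<otimes> (v \<otimes> x) \<otimes> y"
    using v(1) w(1) assms by (simp_all add: mult_assoc)
  then show ?thesis using v w assms
    by (auto simp: invertible_def intro!: bexI[where x="w \<otimes> v"])
qed

text \<open>Commutation makes \<open>w \<otimes> y\<close> a left inverse and
  \<open>y \<otimes> w\<close> a right inverse of \<open>x\<close>, and the two then
  coincide.\<close>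

lemma invertible_factor:
  assumes x: "x \<in> carrier A" "y \<in> carrier A" and comm: "x \<otimes> y = y \<otimes> x"
    and inv: "invertible (x \<otimes> y)"
  shows "invertible x"
proof -
  obtain w where w: "w \<in> carrier A" "(x \<otimes> y) \<otimes> w = \<one>" "w \<otimes> (x \<otimes> y) = \<one>"
    using inv by (auto simp: invertible_def)
  have r: "x \<otimes> (y \<otimes> w) = \<one>" using w x by (simp add: mult_assoc)
  have l: "(w \<otimes> y) \<otimes> x = \<one>" using w x comm by (simp add: mult_assoc)
  have "w \<otimes> y = (w \<otimes> y) \<otimes> (x \<otimes> (y \<otimes> w))" using r w x by simp
  also have "\<dots> = ((w \<otimes> y) \<otimes> x) \<otimes> (y \<otimes> w)" using w(1) x by (simp add: mult_assoc)
  also have "\<dots> = y \<otimes> w" unfolding l using w x by simp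
  finally have "(y \<otimes> w) \<otimes> x = \<one>" using l by simp
  then show ?thesis using r w x by (auto simp: invertible_def intro!: bexI[where x="y \<otimes> w"])
qed

lemma invertible_near_scalar:
  assumes x: "x \<in> carrier A" and less: "\<parallel>of_real M \<odot> \<one> \<ominus> x\<parallel> < M"
  shows "invertible x"
proof -
  let ?z = "of_real (1 / M) \<odot> (of_real M \<odot> \<one> \<ominus> x)"
  have M: "M > 0" using less norm_nonneg[of "of_real M \<odot> \<one> \<ominus> x"] x by simp
  have "\<parallel>?z\<parallel> < 1" using M less x by (simp add: norm_scale norm_divide)
  then have "invertible (of_real M \<odot> (\<one> \<ominus> ?z))"
    using invertible_one_minus[of ?z] M x by (intro invertible_scale) simp_all
  also have "of_real M \<odot> (\<one> \<ominus> ?z) = x"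
    by (rule algebraic_identity[where xs="[x]" and ys="[]"], (rule represent)+) (use M in \<open>simp_all add: x\<close>)
  finally show ?thesis .
qed

text \<open>Measured from the centre \<open>d + \<parallel>x\<parallel>\<close>, the element is at
  distance at most \<open>\<parallel>x\<parallel>\<close>, which leaves room
  \<open>d\<close>.\<close>

lemma invertible_pos_add_square:
  assumes x: "herm_square x" and d: "0 < d"
  shows "invertible (of_real d \<odot> \<one> \<oplus> x)"
proof (rule invertible_near_scalar[where M="d + \<parallel>x\<parallel>"])
  note c = herm_square_closed[OF x]
  show "of_real d \<odot> \<one> \<oplus> x \<in> carrier A" using c by simp
  have "of_real (d + \<parallel>x\<parallel>) \<odot> \<one> \<ominus> (of_real d \<odot> \<one> \<oplus> x) = of_real \<parallel>x\<parallel> \<odot> \<one> \<ominus> x"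
    by (rule algebraic_identity[where xs="[x]" and ys="[]"], (rule represent)+) (simp_all add: c)
  then show "\<parallel>of_real (d + \<parallel>x\<parallel>) \<odot> \<one> \<ominus> (of_real d \<odot> \<one> \<oplus> x)\<parallel> < d + \<parallel>x\<parallel>"
    using herm_square_norm_scalar_minus[OF x order_refl] d by simp
qed

text \<open>Multiplying by the conjugate factor gives
  \<open>(Im c)\<^sup>2 + (x - Re c)\<^sup>2\<close>, a positive scalar plus a square.\<close>

lemma invertible_herm_minus_nonreal:
  assumes x: "x \<in> carrier A" "x\<^sup>\<star> = x" and c: "Im c \<noteq> 0"
  shows "invertible (x \<ominus> c \<odot> \<one>)"
proof (rule invertible_factor[where y="x \<ominus> cnj c \<odot> \<one>"])
  let ?u = "x \<ominus> of_real (Re c) \<odot> \<one>"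
  show "(x \<ominus> c \<odot> \<one>) \<otimes> (x \<ominus> cnj c \<odot> \<one>) = (x \<ominus> cnj c \<odot> \<one>) \<otimes> (x \<ominus> c \<odot> \<one>)"
    by (rule algebraic_identity[where xs="[x]" and ys="[]"], (rule represent)+) (simp_all add: x)
  have us: "?u\<^sup>\<star> = ?u"
    by (rule algebraic_identity[where xs="[]" and ys="[x]"], (rule represent)+) (simp_all add: x)
  have "(x \<ominus> c \<odot> \<one>) \<otimes> (x \<ominus> cnj c \<odot> \<one>) = of_real ((Im c)\<^sup>2) \<odot> \<one> \<oplus> ?u \<otimes> ?u"
    by (rule algebraic_identity[where xs="[x]" and ys="[]"], (rule represent)+)
      (simp_all add: x complex_eq_iff power2_eq_square)
  then show "invertible ((x \<ominus> c \<odot> \<one>) \<otimes> (x \<ominus> cnj c \<odot> \<one>))"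
    using invertible_pos_add_square[OF herm_squareI[of ?u], of "(Im c)\<^sup>2"] us x c by simp
qed (use x in simp_all)

lemma spectrum_eq: "spectrum A x = {c. \<not> invertible (x \<ominus> c \<odot> \<one>)}"
  by (simp add: spectrum_def unital invertible_def)

lemma positive_if_herm_square:
  assumes x: "herm_square x" shows "positive A x"
proof -
  note c = herm_square_closed[OF x] herm_square_star[OF x]
  have "z \<in> complex_of_real ` {0..}" if z: "\<not> invertible (x \<ominus> z \<odot> \<one>)" for z
  proof -
    have "Im z = 0" using invertible_herm_minus_nonreal[OF c] z by blast
    then have zr: "z = of_real (Re z)" by (simp add: complex_eq_iff)
    have "x \<ominus> z \<odot> \<one> = of_real (- Re z) \<odot> \<one> \<oplus> x"
      by (subst zr, rule algebraic_identity[where xs="[x]" and ys="[]"], (rule represent)+) (simp_all add: c)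
    then have "\<not> Re z < 0" using invertible_pos_add_square[OF x, of "- Re z"] z by auto
    then show ?thesis using zr by (metis atLeast_iff imageI not_less)
  qed
  then show ?thesis using c by (auto simp: positive_def spectrum_eq)
qed

text \<open>If \<open>N\<^sup>2 - y\<^sup>2 = s\<^sup>2\<close> were invertible, then \<open>s\<^sup>2 - \<delta>\<close> would still be a square for some
  \<open>\<delta> > 0\<close>, so that \<open>y\<^sup>2 \<le> N\<^sup>2 - \<delta>\<close>. This replaces the spectral radius formula.\<close>

lemma norm_square_minus_square_not_invertible:
  assumes y: "y \<in> carrier A" "y\<^sup>\<star> = y" and pos: "\<parallel>y\<parallel> > 0"
  shows "\<not> invertible (of_real (\<parallel>y\<parallel>\<^sup>2) \<odot> \<one> \<ominus> y \<otimes> y)"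
proof
  let ?N2 = "\<parallel>y\<parallel>\<^sup>2"
  let ?D = "of_real ?N2 \<odot> \<one> \<ominus> y \<otimes> y"
  assume "invertible ?D"
  have N2: "\<parallel>y \<otimes> y\<parallel> = ?N2" using y by (rule norm_square)
  have "herm_square ?D" using y N2 by (intro herm_square_scalar_minus) (simp_all add: star_mult)
  then obtain s where s: "s \<in> carrier A" "s\<^sup>\<star> = s" and D: "?D = s \<otimes> s" by (rule herm_squareE)
  have "invertible s" using \<open>invertible ?D\<close> D s invertible_factor by metis
  then obtain r where r: "r \<in> carrier A" "s \<otimes> r = \<one>" "r \<otimes> s = \<one>" by (auto simp: invertible_def)
  have "r\<^sup>\<star> \<otimes> s = \<one>" using star_mult[of s r] r s by simp
  then have "r\<^sup>\<star> = r" using mult_assoc[of "r\<^sup>\<star>" s r] r s by simp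
  \<comment> \<open>The second bound keeps \<open>\<delta> r\<^sup>2\<close> at norm at most 1, so
    that \<open>1 - \<delta> r\<^sup>2\<close> is a square; the first keeps the scalar
    \<open>\<parallel>y\<parallel>\<^sup>2 - \<delta>\<close> nonnegative.\<close>
  define \<delta> where "\<delta> = min ?N2 (1 / (\<parallel>r \<otimes> r\<parallel> + 1))"
  have K: "0 \<le> \<parallel>r \<otimes> r\<parallel>" using r by (simp add: norm_nonneg)
  have \<delta>: "0 < \<delta>" "\<delta> \<le> ?N2" "\<delta> * \<parallel>r \<otimes> r\<parallel> \<le> 1"
  proof -
    show "0 < \<delta>" "\<delta> \<le> ?N2" using pos K by (auto simp: \<delta>_def)
    have "\<delta> * \<parallel>r \<otimes> r\<parallel> \<le> (1 / (\<parallel>r \<otimes> r\<parallel> + 1)) * \<parallel>r \<otimes> r\<parallel>"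
      using K by (intro mult_right_mono) (auto simp: \<delta>_def)
    also have "\<dots> \<le> 1" using K by simp
    finally show "\<delta> * \<parallel>r \<otimes> r\<parallel> \<le> 1" .
  qed
  let ?E = "\<one> \<ominus> of_real \<delta> \<odot> (r \<otimes> r)"
  have "herm_square (of_real 1 \<odot> \<one> \<ominus> of_real \<delta> \<odot> (r \<otimes> r))"
    using r \<delta> \<open>r\<^sup>\<star> = r\<close> by (intro herm_square_scalar_minus) (simp_all add: star_mult star_scale norm_scale)
  then have E: "herm_square ?E" by simp
  obtain q where q: "q \<in> carrier A" "q\<^sup>\<star> = q" "q \<otimes> q = ?E"
    "\<And>T. closed_unital_subalgebra T \<Longrightarrow> ?E \<in> T \<Longrightarrow> q \<in> T"
    using herm_square_sqrt[OF E] by metis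
  have rs: "(r \<otimes> r) \<otimes> s = r" "s \<otimes> (r \<otimes> r) = r"
    using r s by (simp add: mult_assoc) (simp flip: mult_assoc add: r s)
  have Es: "?E \<otimes> s = s \<otimes> ?E"
    using r s rs by (simp add: cminus_def distrib_left distrib_right scale_mult_left scale_mult_right)
  have qs: "q \<otimes> s = s \<otimes> q"
    using commute_of_closed_unital_subalgebra[OF q(4) herm_square_closed[OF E] s(1) Es] .
  \<comment> \<open>As \<open>q\<close> commutes with \<open>s\<close> and \<open>r\<close> inverts
    \<open>s\<close>, this square is
    \<open>s\<^sup>2 (1 - \<delta> r\<^sup>2) = s\<^sup>2 - \<delta>\<close>.\<close>
  have "(s \<otimes> q) \<otimes> (s \<otimes> q) = s \<otimes> (q \<otimes> s) \<otimes> q" using s q(1) by (simp add: mult_assoc)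
  also have "\<dots> = s \<otimes> (s \<otimes> (q \<otimes> q))" unfolding qs using s q(1) by (simp add: mult_assoc)
  also have "\<dots> = s \<otimes> (s \<ominus> of_real \<delta> \<odot> r)"
    using q(3) s r rs by (simp add: cminus_def distrib_left scale_mult_right)
  also have "\<dots> = ?D \<ominus> of_real \<delta> \<odot> \<one>"
    unfolding D using s r by (simp add: cminus_def distrib_left scale_mult_right)
  finally have "herm_square (?D \<ominus> of_real \<delta> \<odot> \<one>)"
    using herm_squareI[of "s \<otimes> q"] s q qs by (simp add: star_mult)
  then have "\<parallel>y \<otimes> y\<parallel> \<le> \<parallel>y \<otimes> y \<oplus> (?D \<ominus> of_real \<delta> \<odot> \<one>)\<parallel>"
    using herm_square_norm_mono[OF herm_squareI[OF y]] by simp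
  also have "y \<otimes> y \<oplus> (?D \<ominus> of_real \<delta> \<odot> \<one>) = of_real (?N2 - \<delta>) \<odot> \<one>"
    by (rule algebraic_identity[where xs="[y]" and ys="[]"], (rule represent)+) (simp_all add: y)
  finally have "\<parallel>y \<otimes> y\<parallel> \<le> ?N2 - \<delta>" using norm_scalar_le[of "?N2 - \<delta>"] \<delta> by simp
  then show False using N2 \<delta> by simp
qed

text \<open>It suffices that \<open>y = M - x\<close>, with \<open>M\<close> the norm of
  \<open>x\<close>, has norm \<open>N \<le> M\<close>. If \<open>N > M\<close>, then
  \<open>N - y = x - (M - N)\<close> is invertible because \<open>M - N < 0\<close> is outside the
  spectrum, and \<open>N + y = (M + N) - x\<close> is invertible because \<open>x\<close> has norm
  \<open>M < M + N\<close>. Their product \<open>N\<^sup>2 - y\<^sup>2\<close> would be invertible,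
  which was just excluded.\<close>

lemma herm_square_if_positive:
  assumes "positive A x" shows "herm_square x"
proof -
  have x: "x \<in> carrier A" "x\<^sup>\<star> = x"
    and spec: "\<And>c. \<not> invertible (x \<ominus> c \<odot> \<one>) \<Longrightarrow> c \<in> complex_of_real ` {0..}"
    using assms by (auto simp: positive_def spectrum_eq)
  let ?M = "\<parallel>x\<parallel>"
  let ?y = "of_real ?M \<odot> \<one> \<ominus> x"
  let ?N = "\<parallel>?y\<parallel>"
  have y: "?y \<in> carrier A" "?y\<^sup>\<star> = ?y" using x by (simp_all add: scalar_minus_star)
  have "?N \<le> ?M"
  proof (rule ccontr)
    assume gt: "\<not> ?N \<le> ?M"
    then have pos: "?N > 0" using norm_nonneg[OF x(1)] by simp
    let ?P = "of_real ?N \<odot> \<one> \<ominus> ?y" and ?Q = "of_real ?N \<odot> \<one> \<oplus> ?y"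
    have "x \<ominus> of_real (?M - ?N) \<odot> \<one> = ?P"
      by (rule algebraic_identity[where xs="[x]" and ys="[]"], (rule represent)+) (simp_all add: x)
    moreover have "of_real (?M - ?N) \<notin> complex_of_real ` {0..}"
      using gt by (auto simp del: of_real_diff)
    ultimately have P: "invertible ?P" using spec[of "of_real (?M - ?N)"] by auto
    have "of_real (?M + ?N) \<odot> \<one> \<ominus> ?Q = x"
      by (rule algebraic_identity[where xs="[x]" and ys="[]"], (rule represent)+) (simp_all add: x)
    then have Q: "invertible ?Q"
      using pos x by (intro invertible_near_scalar[where M="?M + ?N"]) simp_all
    have "?P \<otimes> ?Q = of_real (?N\<^sup>2) \<odot> \<one> \<ominus> ?y \<otimes> ?y"
      by (rule algebraic_identity[where xs="[x]" and ys="[]"], (rule represent)+)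
        (simp_all add: x power2_eq_square algebra_simps)
    then show False
      using invertible_mult[OF P Q] norm_square_minus_square_not_invertible[OF y pos] x by simp
  qed
  then show ?thesis using herm_square_near_scalar[OF x norm_nonneg[OF x(1)]] by simp
qed

lemma positive_iff_herm_square: "positive A x \<longleftrightarrow> herm_square x"
  using herm_square_if_positive positive_if_herm_square by blast

text \<open>Jacobson's formula: if \<open>w\<close> inverts \<open>c - xy\<close>, then
  \<open>(1 / c) (1 + y w x)\<close> inverts \<open>c - yx\<close>. Hence \<open>xy\<close> and
  \<open>yx\<close> have the same nonzero spectrum.\<close>

lemma invertible_scalar_minus_mult_commute:
  assumes x: "x \<in> carrier A" and y: "y \<in> carrier A" and c: "c \<noteq> 0"
    and inv: "invertible (c \<odot> \<one> \<ominus> x \<otimes> y)"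
  shows "invertible (c \<odot> \<one> \<ominus> y \<otimes> x)"
proof -
  obtain w where w: "w \<in> carrier A" "(c \<odot> \<one> \<ominus> x \<otimes> y) \<otimes> w = \<one>" "w \<otimes> (c \<odot> \<one> \<ominus> x \<otimes> y) = \<one>"
    using inv by (auto simp: invertible_def)
  let ?v = "(1 / c) \<odot> (\<one> \<oplus> y \<otimes> w \<otimes> x)"
  have "(c \<odot> \<one> \<ominus> y \<otimes> x) \<otimes> ?v
      = \<one> \<oplus> (1 / c) \<odot> (y \<otimes> ((c \<odot> \<one> \<ominus> x \<otimes> y) \<otimes> w \<ominus> \<one>) \<otimes> x)"
    by (rule algebraic_identity[where xs="[x,y,w]" and ys="[]"], (rule represent)+)
      (use c in \<open>simp_all add: x y w(1)\<close>)
  moreover have "?v \<otimes> (c \<odot> \<one> \<ominus> y \<otimes> x)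
      = \<one> \<oplus> (1 / c) \<odot> (y \<otimes> (w \<otimes> (c \<odot> \<one> \<ominus> x \<otimes> y) \<ominus> \<one>) \<otimes> x)"
    by (rule algebraic_identity[where xs="[x,y,w]" and ys="[]"], (rule represent)+)
      (use c in \<open>simp_all add: x y w(1)\<close>)
  ultimately show ?thesis using w x y by (auto simp: invertible_def intro!: bexI[where x="?v"])
qed

lemma invertible_minus_scalar_iff:
  assumes "x \<in> carrier A"
  shows "invertible (x \<ominus> c \<odot> \<one>) \<longleftrightarrow> invertible (c \<odot> \<one> \<ominus> x)"
proof -
  have "x \<ominus> c \<odot> \<one> = (-1) \<odot> (c \<odot> \<one> \<ominus> x)" "c \<odot> \<one> \<ominus> x = (-1) \<odot> (x \<ominus> c \<odot> \<one>)"
    by (rule algebraic_identity[where xs="[x]" and ys="[]"], (rule represent)+, simp_all add: assms)+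
  then show ?thesis
    using invertible_scale[of "c \<odot> \<one> \<ominus> x" "-1"] invertible_scale[of "x \<ominus> c \<odot> \<one>" "-1"] assms by auto
qed

text \<open>Kaplansky's argument: with \<open>a = x\<^sup>*x\<close>, \<open>c = |a|\<close> and \<open>m = c - a\<close> (twice the negative part),
  \<open>y = xm\<close> satisfies \<open>y\<^sup>*y = -(qm)\<^sup>2\<close> where \<open>q\<^sup>2 = c\<close>, which forces \<open>y = 0\<close>.\<close>

lemma herm_square_star_mult_self:
  assumes x: "x \<in> carrier A" shows "herm_square (x\<^sup>\<star> \<otimes> x)"
proof -
  define a where "a = x\<^sup>\<star> \<otimes> x"
  have a: "a \<in> carrier A" "a\<^sup>\<star> = a" using x by (simp_all add: a_def star_mult)
  obtain c where c: "c \<in> carrier A" "c\<^sup>\<star> = c" "c \<otimes> c = a \<otimes> a" "herm_square c"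
    "\<And>T. closed_unital_subalgebra T \<Longrightarrow> a \<otimes> a \<in> T \<Longrightarrow> c \<in> T"
    using herm_square_sqrt[OF herm_squareI[OF a]] by metis
  obtain q where q: "q \<in> carrier A" "q\<^sup>\<star> = q" "q \<otimes> q = c"
    "\<And>T. closed_unital_subalgebra T \<Longrightarrow> c \<in> T \<Longrightarrow> q \<in> T"
    using herm_square_sqrt[OF c(4)] by metis
  have ca: "c \<otimes> a = a \<otimes> c"
    using commute_of_closed_unital_subalgebra[OF c(5)] a by (simp add: mult_assoc)
  have qa: "q \<otimes> a = a \<otimes> q" and qc: "q \<otimes> c = c \<otimes> q"
    using commute_of_closed_unital_subalgebra[OF q(4)] a c ca by simp_all
  define m where "m = c \<ominus> a"
  have m: "m \<in> carrier A" using a c by (simp add: m_def)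
  have ms: "m\<^sup>\<star> = m" unfolding m_def
    by (rule algebraic_identity[where xs="[]" and ys="[a,c]"], (rule represent)+) (simp_all add: a c)
  have qm: "q \<otimes> m = m \<otimes> q"
    using q a c qa qc by (simp add: m_def cminus_def distrib_left distrib_right scale_mult_left scale_mult_right)
  define d where "d = q \<otimes> m"
  have d: "d \<in> carrier A" "d\<^sup>\<star> = d" using q m ms qm by (simp_all add: d_def star_mult)
  \<comment> \<open>Since \<open>c\<^sup>2 = a\<^sup>2\<close> and the two commute,
    \<open>(a + c) (c - a) = 0\<close>, so \<open>a\<close> acts on \<open>m\<close> as
    \<open>-c\<close>.\<close>
  have "a \<otimes> m \<oplus> c \<otimes> m = (c \<otimes> c \<ominus> a \<otimes> a) \<oplus> (a \<otimes> c \<ominus> c \<otimes> a)" unfolding m_def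
    by (rule algebraic_identity[where xs="[a,c]" and ys="[]"], (rule represent)+) (simp_all add: a c)
  then have am: "a \<otimes> m \<oplus> c \<otimes> m = \<zero>" using a c ca by simp
  define y where "y = x \<otimes> m"
  have y: "y \<in> carrier A" using x m by (simp add: y_def)
  have "y\<^sup>\<star> \<otimes> y = m \<otimes> (a \<otimes> m)" using x m ms by (simp add: y_def a_def star_mult mult_assoc)
  moreover have "d \<otimes> d = m \<otimes> (c \<otimes> m)"
  proof -
    have "d \<otimes> d = (m \<otimes> q) \<otimes> (q \<otimes> m)" by (simp add: d_def qm)
    also have "\<dots> = m \<otimes> ((q \<otimes> q) \<otimes> m)" using m q(1) by (simp add: mult_assoc)
    finally show ?thesis using q(3) by simp
  qed
  ultimately have sum: "y\<^sup>\<star> \<otimes> y \<oplus> d \<otimes> d = \<zero>"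
    using am m a c by (simp flip: distrib_left)
  define u where "u = (1/2) \<odot> (y \<oplus> y\<^sup>\<star>)"
  define v where "v = (- \<i>/2) \<odot> (y \<ominus> y\<^sup>\<star>)"
  have u: "u \<in> carrier A" and v: "v \<in> carrier A" using y by (simp_all add: u_def v_def)
  have us: "u\<^sup>\<star> = u" unfolding u_def
    by (rule algebraic_identity[where xs="[y]" and ys="[]"], (rule represent)+) (simp_all add: y)
  have vs: "v\<^sup>\<star> = v" unfolding v_def
    by (rule algebraic_identity[where xs="[y]" and ys="[]"], (rule represent)+) (simp_all add: y)
  \<comment> \<open>For real part \<open>u\<close> and imaginary part \<open>v\<close>, the sum of
    \<open>y y\<^sup>\<star>\<close> and \<open>y\<^sup>\<star> y\<close> is
    \<open>2 u\<^sup>2 + 2 v\<^sup>2\<close>; with \<open>y\<^sup>\<star> y = -d\<^sup>2\<close>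
    this exhibits \<open>y y\<^sup>\<star>\<close> as a sum of squares.\<close>
  have "y \<otimes> y\<^sup>\<star> = of_real 2 \<odot> (u \<otimes> u) \<oplus> of_real 2 \<odot> (v \<otimes> v) \<oplus> d \<otimes> d \<ominus> (y\<^sup>\<star> \<otimes> y \<oplus> d \<otimes> d)"
    unfolding u_def v_def
    by (rule algebraic_identity[where xs="[y,d]" and ys="[]"], (rule represent)+) (simp_all add: y d)
  also have "\<dots> = of_real 2 \<odot> (u \<otimes> u) \<oplus> of_real 2 \<odot> (v \<otimes> v) \<oplus> d \<otimes> d \<ominus> \<zero>" by (simp only: sum)
  also have "\<dots> = of_real 2 \<odot> (u \<otimes> u) \<oplus> of_real 2 \<odot> (v \<otimes> v) \<oplus> d \<otimes> d"
    by (rule algebraic_identity[where xs="[u,v,d]" and ys="[]"], (rule represent)+) (simp_all add: u v d)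
  finally have "herm_square (y \<otimes> y\<^sup>\<star>)"
    using herm_square_add[OF herm_square_add] herm_square_scale[OF herm_squareI, of _ 2] u us v vs
      herm_squareI[OF d] by simp
  then have pos: "positive A (y \<otimes> y\<^sup>\<star>)" by (rule positive_if_herm_square)
  \<comment> \<open>Here \<open>c\<close> is a scalar. Swapping the factors preserves the nonzero
    spectrum, and the value 0 is admissible anyway.\<close>
  have "c \<in> complex_of_real ` {0..}" if "\<not> invertible (y\<^sup>\<star> \<otimes> y \<ominus> c \<odot> \<one>)" for c
  proof (cases "c = 0")
    case False
    have "\<not> invertible (y \<otimes> y\<^sup>\<star> \<ominus> c \<odot> \<one>)"
      using that invertible_scalar_minus_mult_commute[of y "y\<^sup>\<star>" c] False y
      by (auto simp: invertible_minus_scalar_iff)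
    then show ?thesis using pos by (auto simp: positive_def spectrum_eq)
  qed simp
  then have "positive A (y\<^sup>\<star> \<otimes> y)" using y by (auto simp: positive_def spectrum_eq star_mult)
  then have yy: "herm_square (y\<^sup>\<star> \<otimes> y)" by (rule herm_square_if_positive)
  have "y\<^sup>\<star> \<otimes> y = \<zero>" using herm_square_sum_zero[OF yy herm_squareI[OF d] sum] .
  then have "d \<otimes> d = \<zero>" using sum d by simp
  then have "q \<otimes> m = \<zero>" using square_eq_zero[of d] d by (simp add: d_def)
  moreover have "c \<otimes> m = q \<otimes> (q \<otimes> m)" using q(1) m by (simp flip: q(3) add: mult_assoc)
  ultimately have cm: "c \<otimes> m = \<zero>" using q(1) by simp
  then have "a \<otimes> m = \<zero>" using am a m by simp
  then have "m \<otimes> m = \<zero>"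
    using cm a c m by (subst (1) m_def) (simp add: cminus_def distrib_right scale_mult_left)
  then have "m = \<zero>" using square_eq_zero[of m] m ms by simp
  then have "c = a" using a c by (simp add: m_def minus_eq_zero_iff)
  then show ?thesis using c(4) by (simp add: a_def)
qed

section \<open>Conjugation, and positivity relative to a subalgebra\<close>

lemma herm_square_conj:
  assumes "herm_square x" "z \<in> carrier A" shows "herm_square (z\<^sup>\<star> \<otimes> x \<otimes> z)"
proof -
  obtain s where s: "s \<in> carrier A" "s\<^sup>\<star> = s" "x = s \<otimes> s" using assms(1) by (rule herm_squareE)
  have "z\<^sup>\<star> \<otimes> x \<otimes> z = (s \<otimes> z)\<^sup>\<star> \<otimes> (s \<otimes> z)" using s assms(2) by (simp add: star_mult mult_assoc)
  then show ?thesis using herm_square_star_mult_self[of "s \<otimes> z"] s assms(2) by simp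
qed

text \<open>Inverses relative to \<open>B\<close> are extended to \<open>A\<close> for
  \<open>c\<close> outside the half-line, in particular \<open>c \<noteq> 0\<close>. If
  \<open>B\<close> has a unit \<open>e\<close>, then \<open>x - c\<close> acts as \<open>-c\<close>
  on the complement of \<open>e\<close>, so \<open>-(1 / c) (1 - e)\<close> is added to the inverse
  in \<open>B\<close>. If \<open>B\<close> has no unit, an inverse \<open>(d, b)\<close> in the
  unitization becomes \<open>b + d 1\<close>.\<close>

lemma positive_in_subalgebra:
  assumes B: "B \<subseteq> carrier A" and pos: "positive (A\<lparr>carrier := B\<rparr>) x"
  shows "positive A x"
proof -
  let ?B = "A\<lparr>carrier := B\<rparr>"
  have xB: "x \<in> B" "x\<^sup>\<star> = x" and spec: "spectrum ?B x \<subseteq> complex_of_real ` {0..}"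
    using pos by (auto simp: positive_def)
  have x: "x \<in> carrier A" using xB B by auto
  have "c \<in> complex_of_real ` {0..}" if ninv: "\<not> invertible (x \<ominus> c \<odot> \<one>)" for c
  proof (rule ccontr)
    assume c: "c \<notin> complex_of_real ` {0..}"
    then have c0: "c \<noteq> 0" by force
    have cs: "c \<notin> spectrum ?B x" using spec c by auto
    show False
    proof (cases "unital ?B")
      case True
      define e where "e = \<one>\<^bsub>?B\<^esub>"
      have e: "e \<in> B" "\<And>z. z \<in> B \<Longrightarrow> e \<otimes> z = z" "\<And>z. z \<in> B \<Longrightarrow> z \<otimes> e = z"
        using unit_is_unit[OF True] by (auto simp: is_unit_def e_def)
      obtain b where b: "b \<in> B" "(x \<ominus> c \<odot> e) \<otimes> b = e" "b \<otimes> (x \<ominus> c \<odot> e) = e"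
        using cs True by (auto simp: spectrum_def e_def cminus_def)
      have cl: "e \<in> carrier A" "b \<in> carrier A" using e(1) b(1) B by auto
      let ?v = "b \<ominus> (1 / c) \<odot> (\<one> \<ominus> e)"
      have "(x \<ominus> c \<odot> \<one>) \<otimes> ?v
          = (x \<ominus> c \<odot> e) \<otimes> b \<oplus> c \<odot> (e \<otimes> b \<ominus> b) \<oplus> (1 / c) \<odot> (x \<otimes> e \<ominus> x) \<oplus> (\<one> \<ominus> e)"
        by (rule algebraic_identity[where xs="[x,b,e]" and ys="[]"], (rule represent)+)
          (use c0 in \<open>simp_all add: x cl\<close>)
      also have "\<dots> = e \<oplus> (\<one> \<ominus> e)" using e(2)[OF b(1)] e(3)[OF xB(1)] b(2) cl x by simp
      also have "\<dots> = \<one>"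
        by (rule algebraic_identity[where xs="[e]" and ys="[]"], (rule represent)+) (simp_all add: cl)
      finally have 1: "(x \<ominus> c \<odot> \<one>) \<otimes> ?v = \<one>" .
      have "?v \<otimes> (x \<ominus> c \<odot> \<one>)
          = b \<otimes> (x \<ominus> c \<odot> e) \<oplus> c \<odot> (b \<otimes> e \<ominus> b) \<oplus> (1 / c) \<odot> (e \<otimes> x \<ominus> x) \<oplus> (\<one> \<ominus> e)"
        by (rule algebraic_identity[where xs="[x,b,e]" and ys="[]"], (rule represent)+)
          (use c0 in \<open>simp_all add: x cl\<close>)
      also have "\<dots> = e \<oplus> (\<one> \<ominus> e)" using e(3)[OF b(1)] e(2)[OF xB(1)] b(3) cl x by simp
      also have "\<dots> = \<one>"
        by (rule algebraic_identity[where xs="[e]" and ys="[]"], (rule represent)+) (simp_all add: cl)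
      finally show False using 1 ninv cl by (auto simp: invertible_def)
    next
      case False
      obtain d b where db: "b \<in> B" "unitization_mult ?B (- c, x) (d, b) = (1, \<zero>)"
          "unitization_mult ?B (d, b) (- c, x) = (1, \<zero>)"
        using cs False by (auto simp: spectrum_def)
      have cl: "b \<in> carrier A" using db(1) B by auto
      have d: "- c * d = 1" "(- c) \<odot> b \<oplus> d \<odot> x \<oplus> x \<otimes> b = \<zero>" "d \<odot> x \<oplus> (- c) \<odot> b \<oplus> b \<otimes> x = \<zero>"
        using db(2,3) by simp_all
      have "(x \<ominus> c \<odot> \<one>) \<otimes> (b \<oplus> d \<odot> \<one>) = (- c * d) \<odot> \<one> \<oplus> ((- c) \<odot> b \<oplus> d \<odot> x \<oplus> x \<otimes> b)"
        by (rule algebraic_identity[where xs="[x,b]" and ys="[]"], (rule represent)+) (simp_all add: x cl)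
      then have 1: "(x \<ominus> c \<odot> \<one>) \<otimes> (b \<oplus> d \<odot> \<one>) = \<one>" using d by simp
      have "(b \<oplus> d \<odot> \<one>) \<otimes> (x \<ominus> c \<odot> \<one>) = (- c * d) \<odot> \<one> \<oplus> (d \<odot> x \<oplus> (- c) \<odot> b \<oplus> b \<otimes> x)"
        by (rule algebraic_identity[where xs="[x,b]" and ys="[]"], (rule represent)+) (simp_all add: x cl)
      then have "(b \<oplus> d \<odot> \<one>) \<otimes> (x \<ominus> c \<odot> \<one>) = \<one>" using d by simp
      then show False using 1 ninv cl by (auto simp: invertible_def)
    qed
  qed
  then show ?thesis using x xB by (auto simp: positive_def spectrum_eq)
qed

section \<open>Projections in hereditary subalgebras\<close>

lemma norm_closed_inD:
  "norm_closed_in A S \<Longrightarrow> (\<And>n::nat. s n \<in> S) \<Longrightarrow> x \<in> carrier A \<Longrightarrow>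
    (\<lambda>n. \<parallel>s n \<ominus> x\<parallel>) \<longlonglongrightarrow> 0 \<Longrightarrow> x \<in> S"
  unfolding norm_closed_in_def by blast

lemma cstar_subalgebraD:
  assumes "cstar_subalgebra A B"
  shows "B \<subseteq> carrier A" "\<zero> \<in> B"
    and "x \<in> B \<Longrightarrow> y \<in> B \<Longrightarrow> x \<oplus> y \<in> B" "x \<in> B \<Longrightarrow> y \<in> B \<Longrightarrow> x \<otimes> y \<in> B"
    and "x \<in> B \<Longrightarrow> x\<^sup>\<star> \<in> B" "x \<in> B \<Longrightarrow> c \<odot> x \<in> B"
  using assms by (auto simp: cstar_subalgebra_def norm_closed_in_def)

text \<open>Heredity applies because \<open>h k h\<close> is dominated by
  \<open>\<parallel>k\<parallel> h\<^sup>2\<close>, which lies in \<open>H\<close>; being a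
  self-adjoint idempotent, \<open>h k h\<close> is its own square and so positive.\<close>

lemma idempotent_in_hereditary:
  assumes H: "hereditary_subalgebra A H" and h: "h \<in> H" "h\<^sup>\<star> = h"
    and k: "k \<in> carrier A" "k\<^sup>\<star> = k" and idem: "(h \<otimes> k \<otimes> h) \<otimes> (h \<otimes> k \<otimes> h) = h \<otimes> k \<otimes> h"
  shows "h \<otimes> k \<otimes> h \<in> H"
proof -
  let ?p = "h \<otimes> k \<otimes> h" and ?y = "of_real \<parallel>k\<parallel> \<odot> (h \<otimes> h)"
  have sub: "cstar_subalgebra A H" using H by (simp add: hereditary_subalgebra_def)
  note subD = cstar_subalgebraD[OF sub]
  have hc: "h \<in> carrier A" using h subD(1) by auto
  have ps: "?p\<^sup>\<star> = ?p" using hc k h by (simp add: star_mult mult_assoc)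
  have "herm_square ?p" using herm_squareI[of ?p] ps idem hc k by simp
  have "?y \<ominus> ?p = h\<^sup>\<star> \<otimes> (of_real \<parallel>k\<parallel> \<odot> \<one> \<ominus> k) \<otimes> h"
    by (rule algebraic_identity[where xs="[k]" and ys="[h]"], (rule represent)+) (simp_all add: hc h k)
  then have "herm_square (?y \<ominus> ?p)"
    using herm_square_conj[OF herm_square_scalar_minus[OF k order_refl] hc] by simp
  then have "cle A ?p ?y" using hc k by (simp add: cle_def positive_iff_herm_square)
  moreover have "?y \<in> H" using h subD by simp
  ultimately show ?thesis
    using H \<open>herm_square ?p\<close> hc k
    unfolding hereditary_subalgebra_def by (meson closed positive_if_herm_square)
qed

text \<open>If \<open>0 \<le> x \<le> y\<close> and \<open>y z = 0\<close>, then
  \<open>z x z\<close> and \<open>z (y - x) z\<close> are squares with sum 0, so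
  \<open>z x z = 0\<close>; writing \<open>x = s\<^sup>2\<close> gives \<open>s z = 0\<close>. The
  element \<open>z\<close> is taken in \<open>A\<close>, since the one needed later involves the
  unit of \<open>A\<close>.\<close>

lemma hereditary_annihilator:
  assumes B: "cstar_subalgebra A B" and z: "z \<in> carrier A" "z\<^sup>\<star> = z"
  shows "hereditary_subalgebra (A\<lparr>carrier := B\<rparr>) {x \<in> B. x \<otimes> z = \<zero> \<and> z \<otimes> x = \<zero>}" (is "hereditary_subalgebra ?B ?H")
proof -
  note BD = cstar_subalgebraD[OF B]
  have Bc: "x \<in> carrier A" if "x \<in> B" for x using that BD(1) by auto
  have minus: "x \<ominus>\<^bsub>?B\<^esub> y = x \<ominus> y" for x y by (simp add: cminus_def)
  have lim: "x \<otimes> z = \<zero> \<and> z \<otimes> x = \<zero>"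
    if s: "\<And>n. s n \<in> ?H" and x: "x \<in> B" and lim: "(\<lambda>n. \<parallel>s n \<ominus> x\<parallel>) \<longlonglongrightarrow> 0" for s :: "nat \<Rightarrow> 'a" and x
  proof -
    have sn: "s n \<in> carrier A" "s n \<otimes> z = \<zero>" "z \<otimes> s n = \<zero>" for n using s[of n] Bc by auto
    have l: "(\<lambda>n. \<parallel>z\<parallel> * \<parallel>s n \<ominus> x\<parallel>) \<longlonglongrightarrow> 0" using tendsto_mult_right_zero[OF lim] by simp
    have "\<parallel>\<zero> \<ominus> x \<otimes> z\<parallel> \<le> \<parallel>z\<parallel> * \<parallel>s n \<ominus> x\<parallel>" for n
    proof -
      have "(s n \<ominus> x) \<otimes> z = s n \<otimes> z \<ominus> x \<otimes> z"
        by (rule algebraic_identity[where xs="[s n,x,z]" and ys="[]"], (rule represent)+) (simp_all add: sn(1) z Bc x)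
      then show ?thesis using norm_mult[of "s n \<ominus> x" z] sn z Bc[OF x] by (simp add: mult.commute)
    qed
    then have 1: "\<zero> = x \<otimes> z" using Bc[OF x] z by (intro eq_if_norm_minus_tendsto_0[OF _ _ l]) simp_all
    have "\<parallel>\<zero> \<ominus> z \<otimes> x\<parallel> \<le> \<parallel>z\<parallel> * \<parallel>s n \<ominus> x\<parallel>" for n
    proof -
      have "z \<otimes> (s n \<ominus> x) = z \<otimes> s n \<ominus> z \<otimes> x"
        by (rule algebraic_identity[where xs="[s n,x,z]" and ys="[]"], (rule represent)+) (simp_all add: sn(1) z Bc x)
      then show ?thesis using norm_mult[of z "s n \<ominus> x"] sn z Bc[OF x] by simp
    qed
    then have 2: "\<zero> = z \<otimes> x" using Bc[OF x] z by (intro eq_if_norm_minus_tendsto_0[OF _ _ l]) simp_all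
    show ?thesis using 1 2 by simp
  qed
  have closed: "norm_closed_in ?B ?H"
    unfolding norm_closed_in_def minus
  proof (intro conjI allI impI)
    fix s x assume *: "(\<forall>n::nat. s n \<in> ?H) \<and> x \<in> carrier ?B \<and> (\<lambda>n. \<parallel>s n \<ominus> x\<parallel>\<^bsub>?B\<^esub>) \<longlonglongrightarrow> 0"
    have 1: "s n \<in> ?H" for n using * by blast
    have 2: "x \<in> B" "(\<lambda>n. \<parallel>s n \<ominus> x\<parallel>) \<longlonglongrightarrow> 0" using * by simp_all
    show "x \<in> ?H" using lim[OF 1 2] 2(1) by simp
  qed auto
  have add_mult: "x \<oplus> y \<in> ?H" "x \<otimes> y \<in> ?H" if "x \<in> ?H" "y \<in> ?H" for x y
  proof -
    have xy: "x \<in> carrier A" "y \<in> carrier A" using that Bc by auto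
    show "x \<oplus> y \<in> ?H" using that xy z BD by (simp add: distrib_left distrib_right)
    have "(x \<otimes> y) \<otimes> z = x \<otimes> (y \<otimes> z)" "z \<otimes> (x \<otimes> y) = (z \<otimes> x) \<otimes> y"
      using xy z by (simp_all add: mult_assoc)
    then show "x \<otimes> y \<in> ?H" using that xy BD by simp
  qed
  have star_scale: "x\<^sup>\<star> \<in> ?H" "c \<odot> x \<in> ?H" if "x \<in> ?H" for x c
  proof -
    have x: "x \<in> carrier A" using that Bc by auto
    have "(x\<^sup>\<star> \<otimes> z) = (z \<otimes> x)\<^sup>\<star>" "z \<otimes> x\<^sup>\<star> = (x \<otimes> z)\<^sup>\<star>" using x z by (simp_all add: star_mult)
    then show "x\<^sup>\<star> \<in> ?H" "c \<odot> x \<in> ?H"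
      using that x z BD by (simp_all add: scale_mult_left scale_mult_right)
  qed
  have ops: "cadd ?B = cadd A" "cmult ?B = cmult A" "cscale ?B = cscale A" "cstar ?B = cstar A"
    by simp_all
  have "\<zero>\<^bsub>?B\<^esub> \<in> ?H" using BD(2) z by simp
  then have sub: "cstar_subalgebra ?B ?H"
    unfolding cstar_subalgebra_def
    by (intro conjI ballI allI closed; simp only: ops add_mult star_scale)
  have her: "x \<in> ?H"
    if xB: "x \<in> B" and y: "y \<in> ?H" and pos: "positive ?B x" and le: "cle ?B x y" for x y
  proof -
    have cl: "x \<in> carrier A" "y \<in> carrier A" using xB y Bc by auto
    obtain s where s: "s \<in> carrier A" "s\<^sup>\<star> = s" "x = s \<otimes> s"
      using herm_square_if_positive[OF positive_in_subalgebra[OF BD(1) pos]] by (rule herm_squareE)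
    have "positive ?B (y \<ominus> x)" using le by (simp add: cle_def minus)
    then have d: "herm_square (y \<ominus> x)"
      using positive_in_subalgebra[OF BD(1)] herm_square_if_positive by blast
    have hx: "herm_square x" using herm_squareI[OF s(1,2)] s(3) by simp
    have "z\<^sup>\<star> \<otimes> x \<otimes> z \<oplus> z\<^sup>\<star> \<otimes> (y \<ominus> x) \<otimes> z = z\<^sup>\<star> \<otimes> (y \<otimes> z)"
      by (rule algebraic_identity[where xs="[x,y,z]" and ys="[]"], (rule represent)+) (simp_all add: cl z)
    also have "\<dots> = \<zero>" using y z by simp
    finally have "z\<^sup>\<star> \<otimes> x \<otimes> z = \<zero>"
      using herm_square_sum_zero[OF herm_square_conj[OF hx z(1)] herm_square_conj[OF d z(1)]] by simp
    then have "(s \<otimes> z)\<^sup>\<star> \<otimes> (s \<otimes> z) = \<zero>" using s z(1) by (simp add: star_mult mult_assoc)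
    then have sz: "s \<otimes> z = \<zero>" using square_eq_zero[of "s \<otimes> z"] s(1) z by simp
    have xz: "x \<otimes> z = \<zero>" using s(1,3) sz z by (simp add: mult_assoc)
    have "z \<otimes> x = (x \<otimes> z)\<^sup>\<star>" using z cl herm_square_star[OF hx] by (simp add: star_mult)
    then show ?thesis using xz xB by simp
  qed
  show ?thesis unfolding hereditary_subalgebra_def
    by (intro conjI sub ballI impI) (rule her, auto)
qed

text \<open>If \<open>x + x\<^sup>\<star>\<close> vanishes, then \<open>x\<close> is skew-adjoint
  and \<open>\<i> \<odot> x\<close> is self-adjoint; one of the two is non-zero and can be
  normalised.\<close>

lemma unit_norm_hermitian_in_subalgebra:
  assumes H: "cstar_subalgebra A H" and ne: "H \<noteq> {\<zero>}"
  obtains h where "h \<in> H" "h\<^sup>\<star> = h" "\<parallel>h\<parallel> = 1"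
proof -
  note HD = cstar_subalgebraD[OF H]
  obtain x where x: "x \<in> H" "x \<noteq> \<zero>" using ne HD(2) by auto
  have xc: "x \<in> carrier A" using x HD(1) by auto
  obtain u where u: "u \<in> H" "u\<^sup>\<star> = u" "u \<noteq> \<zero>"
  proof (cases "x \<oplus> x\<^sup>\<star> = \<zero>")
    case True
    show ?thesis
    proof (rule that[of "\<i> \<odot> x"])
      have "(\<i> \<odot> x)\<^sup>\<star> = \<i> \<odot> x \<oplus> (- \<i>) \<odot> (x \<oplus> x\<^sup>\<star>)"
        by (rule algebraic_identity[where xs="[x]" and ys="[]"], (rule represent)+) (simp_all add: xc)
      then show "(\<i> \<odot> x)\<^sup>\<star> = \<i> \<odot> x" using True xc by simp
      show "\<i> \<odot> x \<in> H" using x HD by simp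
      show "\<i> \<odot> x \<noteq> \<zero>"
        using norm_scale[OF xc, of \<i>] norm_eq_zero[OF xc] norm_eq_zero[of "\<i> \<odot> x"] x xc by simp
    qed
  next
    case False
    have "(x \<oplus> x\<^sup>\<star>)\<^sup>\<star> = x \<oplus> x\<^sup>\<star>" using xc add_commute[of x "x\<^sup>\<star>"] by (simp add: star_add)
    then show ?thesis using that[of "x \<oplus> x\<^sup>\<star>"] False x HD by simp
  qed
  have uc: "u \<in> carrier A" using u HD(1) by auto
  have "\<parallel>u\<parallel> \<noteq> 0" using u uc norm_eq_zero by simp
  moreover have "0 \<le> \<parallel>u\<parallel>" using uc by (rule norm_nonneg)
  ultimately show ?thesis
    using that[of "of_real (1 / \<parallel>u\<parallel>) \<odot> u"] u uc HD
    by (simp add: star_scale norm_scale norm_divide)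
qed

text \<open>With \<open>y = pgh\<close>, the element \<open>d = yy\<^sup>*\<close> is invertible in the corner \<open>pAp\<close>, with inverse \<open>f\<close>
  say, and \<open>y\<^sup>*fy = h(gfg)h\<close> is the projection obtained.\<close>

lemma idempotent_from_corner:
  assumes h: "h \<in> carrier A" "h\<^sup>\<star> = h" and g: "g \<in> carrier A" "g\<^sup>\<star> = g"
    and p: "p \<in> carrier A" "p\<^sup>\<star> = p" "p \<otimes> p = p" "p \<noteq> \<zero>"
    and near: "\<parallel>of_real M \<odot> p \<ominus> p \<otimes> (g \<otimes> (h \<otimes> h) \<otimes> g) \<otimes> p\<parallel> < M"
  obtains k where "k \<in> carrier A" "k\<^sup>\<star> = k"
    "(h \<otimes> k \<otimes> h) \<otimes> (h \<otimes> k \<otimes> h) = h \<otimes> k \<otimes> h" "h \<otimes> k \<otimes> h \<noteq> \<zero>"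
proof -
  define e where "e = g \<otimes> (h \<otimes> h) \<otimes> g"
  define d where "d = p \<otimes> e \<otimes> p"
  have e: "e \<in> carrier A" "e\<^sup>\<star> = e" using g h by (simp_all add: e_def star_mult mult_assoc)
  have d: "d \<in> carrier A" "d\<^sup>\<star> = d" using p e by (simp_all add: d_def star_mult mult_assoc)
  have pd: "p \<otimes> d = d" and dp: "d \<otimes> p = d"
  proof -
    have "p \<otimes> d = (p \<otimes> p) \<otimes> e \<otimes> p" "d \<otimes> p = p \<otimes> e \<otimes> (p \<otimes> p)"
      using p(1) e(1) by (simp_all add: d_def mult_assoc)
    then show "p \<otimes> d = d" "d \<otimes> p = d" unfolding p(3) by (simp_all add: d_def)
  qed
  \<comment> \<open>Adding \<open>M\<close> on the complement of \<open>p\<close> turns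
    invertibility in \<open>pAp\<close> into invertibility in \<open>A\<close>:
    \<open>M - x = M p - d\<close> has norm below \<open>M\<close>.\<close>
  define x where "x = d \<oplus> of_real M \<odot> (\<one> \<ominus> p)"
  have x: "x \<in> carrier A" using d p by (simp add: x_def)
  have xs: "x\<^sup>\<star> = x" unfolding x_def
    by (rule algebraic_identity[where xs="[]" and ys="[d,p]"], (rule represent)+) (simp_all add: d p(1,2))
  have "p \<otimes> x = p \<otimes> d \<oplus> of_real M \<odot> (p \<ominus> p \<otimes> p)" unfolding x_def
    by (rule algebraic_identity[where xs="[d,p]" and ys="[]"], (rule represent)+) (simp_all add: d p(1))
  then have px: "p \<otimes> x = d" using pd p(1,3) d by simp
  have "x \<otimes> p = d \<otimes> p \<oplus> of_real M \<odot> (p \<ominus> p \<otimes> p)" unfolding x_def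
    by (rule algebraic_identity[where xs="[d,p]" and ys="[]"], (rule represent)+) (simp_all add: d p(1))
  then have xp: "x \<otimes> p = d" using dp p(1,3) d by simp
  have "of_real M \<odot> \<one> \<ominus> x = of_real M \<odot> p \<ominus> d" unfolding x_def
    by (rule algebraic_identity[where xs="[d,p]" and ys="[]"], (rule represent)+) (simp_all add: d p(1))
  then have "invertible x" using near x by (intro invertible_near_scalar[of x M]) (simp_all add: d_def e_def)
  then obtain r where r: "r \<in> carrier A" "x \<otimes> r = \<one>" "r \<otimes> x = \<one>" by (auto simp: invertible_def)
  have "r\<^sup>\<star> \<otimes> x = \<one>" using star_mult[of x r] r x xs by simp
  then have rs: "r\<^sup>\<star> = r" using mult_assoc[of "r\<^sup>\<star>" x r] r x by simp
  \<comment> \<open>The inverse of \<open>x\<close> commutes with \<open>p\<close> because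
    \<open>p x = d = x p\<close>.\<close>
  have "r \<otimes> p = r \<otimes> (p \<otimes> x) \<otimes> r" using r p(1) x by (simp add: mult_assoc)
  also have "\<dots> = (r \<otimes> x) \<otimes> p \<otimes> r" unfolding px xp[symmetric] using r(1) p(1) x by (simp add: mult_assoc)
  finally have rp: "r \<otimes> p = p \<otimes> r" using r p(1) by simp
  define f where "f = p \<otimes> r"
  have f: "f \<in> carrier A" "f\<^sup>\<star> = f" using p r rs rp by (simp_all add: f_def star_mult)
  have pf: "p \<otimes> f = f" using p(1,3) r(1) by (simp add: f_def flip: mult_assoc)
  have fp: "f \<otimes> p = f" using p(1,3) r(1) rp by (simp add: f_def mult_assoc flip: rp)
  have "d \<otimes> f = (d \<otimes> p) \<otimes> r" using d(1) p(1) r(1) by (simp add: f_def mult_assoc)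
  also have "\<dots> = (p \<otimes> x) \<otimes> r" by (simp only: dp px)
  also have "\<dots> = p \<otimes> (x \<otimes> r)" using p(1) r(1) x by (simp only: mult_assoc)
  finally have df: "d \<otimes> f = p" using r p(1) by simp
  have "(d \<otimes> f)\<^sup>\<star> = f \<otimes> d" using d f by (simp add: star_mult)
  then have fd: "f \<otimes> d = p" using df p(2) by simp
  have "f \<otimes> e \<otimes> f = (f \<otimes> p) \<otimes> e \<otimes> (p \<otimes> f)" by (simp only: pf fp)
  also have "\<dots> = (f \<otimes> d) \<otimes> f" using f(1) p(1) e(1) by (simp add: d_def mult_assoc)
  finally have fef: "f \<otimes> e \<otimes> f = f" using fd pf by simp
  let ?k = "g \<otimes> f \<otimes> g"
  show ?thesis
  proof (rule that[of ?k])
    show "?k \<in> carrier A" "?k\<^sup>\<star> = ?k" using g f by (simp_all add: star_mult mult_assoc)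
    \<comment> \<open>The inner factors \<open>g h h g\<close> form \<open>e\<close>, and
      \<open>f e f = f\<close> because \<open>f\<close> inverts \<open>p e p\<close> in the
      corner.\<close>
    have "(h \<otimes> ?k \<otimes> h) \<otimes> (h \<otimes> ?k \<otimes> h) = h \<otimes> g \<otimes> (f \<otimes> e \<otimes> f) \<otimes> g \<otimes> h"
      using h(1) g(1) f(1) by (simp add: e_def mult_assoc)
    then show "(h \<otimes> ?k \<otimes> h) \<otimes> (h \<otimes> ?k \<otimes> h) = h \<otimes> ?k \<otimes> h"
      unfolding fef using h(1) g(1) f(1) by (simp add: mult_assoc)
    \<comment> \<open>Otherwise \<open>e f e = 0\<close>, whence \<open>f = f e f e f = 0\<close>
      and \<open>p = d f = 0\<close>.\<close>
    show "h \<otimes> ?k \<otimes> h \<noteq> \<zero>"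
    proof
      assume 0: "h \<otimes> ?k \<otimes> h = \<zero>"
      have "e \<otimes> f \<otimes> e = g \<otimes> h \<otimes> (h \<otimes> ?k \<otimes> h) \<otimes> h \<otimes> g"
        using h(1) g(1) f(1) by (simp add: e_def mult_assoc)
      then have efe: "e \<otimes> f \<otimes> e = \<zero>" using 0 h g by simp
      have "f = (f \<otimes> e \<otimes> f) \<otimes> e \<otimes> f" by (simp only: fef)
      also have "\<dots> = f \<otimes> (e \<otimes> f \<otimes> e) \<otimes> f" using f(1) e(1) by (simp add: mult_assoc)
      also have "\<dots> = \<zero>" using efe f by simp
      finally have "p = \<zero>" using df d by simp
      then show False using p(4) by simp
    qed
  qed
qed

text \<open>Roots of elements of \<complex>1 + \<open>B\<close> need not lie in \<open>B\<close>,
  but they lie in this set, so they still carry \<open>B\<close> into \<open>B\<close>.\<close>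

lemma closed_unital_subalgebra_multiplier:
  assumes B: "cstar_subalgebra A B"
  shows "closed_unital_subalgebra {y \<in> carrier A. \<forall>x\<in>B. y \<otimes> x \<in> B}"
proof -
  note BD = cstar_subalgebraD[OF B]
  have Bc: "x \<in> carrier A" if "x \<in> B" for x using that BD(1) by auto
  have mem: "y \<otimes> x \<in> B"
    if s: "\<And>n. s n \<in> carrier A \<and> s n \<otimes> x \<in> B" and y: "y \<in> carrier A" and x: "x \<in> carrier A"
      and lim: "(\<lambda>n. \<parallel>s n \<ominus> y\<parallel>) \<longlonglongrightarrow> 0" for s :: "nat \<Rightarrow> 'a" and x y
  proof -
    have "(\<lambda>n. \<parallel>s n \<otimes> x \<ominus> y \<otimes> x\<parallel>) \<longlonglongrightarrow> 0"
    proof (rule tendsto_sandwich[OF _ _ tendsto_const tendsto_mult_left_zero[OF lim, of "\<parallel>x\<parallel>"]])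
      have "s n \<otimes> x \<ominus> y \<otimes> x = (s n \<ominus> y) \<otimes> x" for n
        by (rule algebraic_identity[where xs="[s n,y,x]" and ys="[]"], (rule represent)+) (use s x y in simp_all)
      then show "\<forall>\<^sub>F n in sequentially. \<parallel>s n \<otimes> x \<ominus> y \<otimes> x\<parallel> \<le> \<parallel>s n \<ominus> y\<parallel> * \<parallel>x\<parallel>"
        using norm_mult[of "s _ \<ominus> y" x] s x y by simp
      show "\<forall>\<^sub>F n in sequentially. 0 \<le> \<parallel>s n \<otimes> x \<ominus> y \<otimes> x\<parallel>"
        using s x y by (simp add: norm_nonneg)
    qed
    moreover have "y \<otimes> x \<in> carrier A" using x y by simp
    moreover have "norm_closed_in A B" using B by (simp add: cstar_subalgebra_def)
    ultimately show ?thesis using s norm_closed_inD[of B "\<lambda>n. s n \<otimes> x"] by simp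
  qed
  have "norm_closed_in A {y \<in> carrier A. \<forall>x\<in>B. y \<otimes> x \<in> B}"
    unfolding norm_closed_in_def
  proof (intro conjI allI impI)
    fix s y
    assume "(\<forall>n::nat. s n \<in> {y \<in> carrier A. \<forall>x\<in>B. y \<otimes> x \<in> B}) \<and> y \<in> carrier A
      \<and> (\<lambda>n. \<parallel>s n \<ominus> y\<parallel>) \<longlonglongrightarrow> 0"
    then show "y \<in> {y \<in> carrier A. \<forall>x\<in>B. y \<otimes> x \<in> B}"
      using mem[of s _ y] Bc by simp
  qed auto
  then show ?thesis
    using Bc BD by (auto simp: closed_unital_subalgebra_def distrib_right scale_mult_left mult_assoc)
qed

text \<open>As \<open>x\<close> is self-adjoint, \<open>b\<close> and \<open>b\<^sup>\<star>\<close>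
  are equally far from it, and their mean is no farther.\<close>

lemma hermitian_approximation:
  assumes B: "cstar_subalgebra A B" and b: "b \<in> B" and x: "x \<in> carrier A" "x\<^sup>\<star> = x"
  obtains b' where "b' \<in> B" "b'\<^sup>\<star> = b'" "\<parallel>x \<ominus> b'\<parallel> \<le> \<parallel>x \<ominus> b\<parallel>"
proof -
  note BD = cstar_subalgebraD[OF B]
  have bc: "b \<in> carrier A" using b BD(1) by auto
  let ?b = "(1/2) \<odot> (b \<oplus> b\<^sup>\<star>)"
  have "x \<ominus> ?b = (1/2) \<odot> ((x \<ominus> b) \<oplus> (x \<ominus> b)\<^sup>\<star>)"
    by (rule algebraic_identity[where xs="[b]" and ys="[x]"], (rule represent)+) (simp_all add: bc x)
  then have "\<parallel>x \<ominus> ?b\<parallel> \<le> \<parallel>x \<ominus> b\<parallel>"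
    using norm_triangle[of "x \<ominus> b" "(x \<ominus> b)\<^sup>\<star>"] norm_star[of "x \<ominus> b"] bc x by (simp add: norm_scale)
  moreover have "?b\<^sup>\<star> = ?b"
    by (rule algebraic_identity[where xs="[b]" and ys="[]"], (rule represent)+) (simp_all add: bc)
  moreover have "?b \<in> B" using b BD by simp
  ultimately show ?thesis using that by blast
qed

text \<open>With \<open>k = b - t\<close> and \<open>c = |k|\<close>, the elements
  \<open>w = c + k\<close> and \<open>z = c - k\<close> are twice the positive and negative parts of
  \<open>k\<close>. The annihilator of \<open>z\<close> is non-zero because it contains
  \<open>w b\<close>. A projection \<open>p\<close> in it satisfies
  \<open>p k p = p c p \<ge> 0\<close>, so
  \<open>t p \<le> p b p \<le> \<parallel>b\<parallel> p\<close>.\<close>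

lemma spectral_corner_projection:
  assumes B: "cstar_subalgebra A B" and SP: "property_SP (A\<lparr>carrier := B\<rparr>)"
    and b: "b \<in> B" "b\<^sup>\<star> = b" and t: "0 < t" "\<not> herm_square (of_real t \<odot> \<one> \<ominus> b)"
  obtains p where "p \<in> carrier A" "p\<^sup>\<star> = p" "p \<otimes> p = p" "p \<noteq> \<zero>"
    "\<parallel>of_real \<parallel>b\<parallel> \<odot> p \<ominus> p \<otimes> b \<otimes> p\<parallel> \<le> \<bar>\<parallel>b\<parallel> - t\<bar>"
proof -
  note BD = cstar_subalgebraD[OF B]
  have bc: "b \<in> carrier A" using b BD(1) by auto
  define k where "k = b \<ominus> of_real t \<odot> \<one>"
  have k: "k \<in> carrier A" using bc by (simp add: k_def)
  have ks: "k\<^sup>\<star> = k" unfolding k_def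
    by (rule algebraic_identity[where xs="[]" and ys="[b]"], (rule represent)+) (simp_all add: bc b)
  obtain c where c: "c \<in> carrier A" "c\<^sup>\<star> = c" "c \<otimes> c = k \<otimes> k" "herm_square c"
    "\<And>T. closed_unital_subalgebra T \<Longrightarrow> k \<otimes> k \<in> T \<Longrightarrow> c \<in> T"
    using herm_square_sqrt[OF herm_squareI[OF k ks]] by metis
  have "(k \<otimes> k) \<otimes> b = b \<otimes> (k \<otimes> k)" unfolding k_def
    by (rule algebraic_identity[where xs="[b]" and ys="[]"], (rule represent)+) (simp_all add: bc)
  then have cb: "c \<otimes> b = b \<otimes> c"
    using commute_of_closed_unital_subalgebra[OF c(5)] k bc by simp
  have ck: "c \<otimes> k = k \<otimes> c"
    using cb bc c by (simp add: k_def cminus_def distrib_left distrib_right scale_mult_left scale_mult_right)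
  have kb: "k \<otimes> b = b \<otimes> k" unfolding k_def
    by (rule algebraic_identity[where xs="[b]" and ys="[]"], (rule represent)+) (simp_all add: bc)
  define z where "z = c \<ominus> k"
  define w where "w = c \<oplus> k"
  have z: "z \<in> carrier A" and w: "w \<in> carrier A" using c k by (simp_all add: z_def w_def)
  have zs: "z\<^sup>\<star> = z" unfolding z_def
    by (rule algebraic_identity[where xs="[]" and ys="[c,k]"], (rule represent)+) (simp_all add: c k ks)
  have zb: "z \<otimes> b = b \<otimes> z"
    using cb kb bc c k by (simp add: z_def cminus_def distrib_left distrib_right scale_mult_left scale_mult_right)
  have wz: "w \<otimes> z = \<zero>" and zw: "z \<otimes> w = \<zero>"
  proof -
    have "w \<otimes> z = (c \<otimes> c \<ominus> k \<otimes> k) \<ominus> (c \<otimes> k \<ominus> k \<otimes> c)" unfolding w_def z_def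
      by (rule algebraic_identity[where xs="[c,k]" and ys="[]"], (rule represent)+) (simp_all add: c k)
    moreover have "z \<otimes> w = (c \<otimes> c \<ominus> k \<otimes> k) \<oplus> (c \<otimes> k \<ominus> k \<otimes> c)" unfolding w_def z_def
      by (rule algebraic_identity[where xs="[c,k]" and ys="[]"], (rule represent)+) (simp_all add: c k)
    ultimately show "w \<otimes> z = \<zero>" "z \<otimes> w = \<zero>" using c k ck by simp_all
  qed
  let ?H = "{x \<in> B. x \<otimes> z = \<zero> \<and> z \<otimes> x = \<zero>}"
  \<comment> \<open>The factor \<open>b\<close> is there because \<open>w\<close> itself involves
    the unit of \<open>A\<close> and need not lie in \<open>B\<close>.\<close>
  have "w \<otimes> b \<in> B"
  proof -
    let ?T = "{y \<in> carrier A. \<forall>x\<in>B. y \<otimes> x \<in> B}"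
    note T = closed_unital_subalgebra_multiplier[OF B]
    have "b \<in> ?T" using bc b BD by simp
    moreover have "of_real t \<odot> \<one> \<in> ?T" using T unfolding closed_unital_subalgebra_def by blast
    ultimately have kT: "k \<in> ?T" unfolding k_def by (rule closed_unital_subalgebra_minus[OF T])
    then have "k \<otimes> k \<in> ?T" using T unfolding closed_unital_subalgebra_def by blast
    then have "c \<in> ?T" by (rule c(5)[OF T])
    then have "w \<in> ?T" using T kT unfolding closed_unital_subalgebra_def w_def by blast
    then show ?thesis using b by simp
  qed
  moreover have "(w \<otimes> b) \<otimes> z = (w \<otimes> z) \<otimes> b" using w bc z zb by (simp add: mult_assoc)
  moreover have "z \<otimes> (w \<otimes> b) = (z \<otimes> w) \<otimes> b" using w bc z by (simp add: mult_assoc)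
  ultimately have wbH: "w \<otimes> b \<in> ?H" using wz zw bc by simp
  have wb: "w \<otimes> b \<noteq> \<zero>"
  proof
    assume 0: "w \<otimes> b = \<zero>"
    \<comment> \<open>From \<open>w z = 0\<close> follows \<open>w (t + c) = w b\<close>. As
      \<open>t + c\<close> is invertible, \<open>w b = 0\<close> would give \<open>w = 0\<close>,
      and \<open>t - b = -k = c\<close> would be a square.\<close>
    let ?v = "of_real t \<odot> \<one> \<oplus> c"
    have "w \<otimes> ?v = w \<otimes> b \<oplus> (c \<otimes> c \<ominus> k \<otimes> k) \<ominus> (c \<otimes> k \<ominus> k \<otimes> c)"
      unfolding w_def k_def
      by (rule algebraic_identity[where xs="[b,c]" and ys="[]"], (rule represent)+) (simp_all add: bc c)
    then have wv: "w \<otimes> ?v = \<zero>" using 0 c k ck by simp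
    obtain r where r: "r \<in> carrier A" "?v \<otimes> r = \<one>"
      using invertible_pos_add_square[OF c(4) t(1)] by (auto simp: invertible_def)
    have "w = (w \<otimes> ?v) \<otimes> r" using r w c(1) by (simp add: mult_assoc)
    then have "w = \<zero>" using wv r by simp
    moreover have "of_real t \<odot> \<one> \<ominus> b = c \<ominus> w" unfolding w_def k_def
      by (rule algebraic_identity[where xs="[b,c]" and ys="[]"], (rule represent)+) (simp_all add: bc c)
    moreover have "c \<ominus> \<zero> = c"
      by (rule algebraic_identity[where xs="[c]" and ys="[]"], (rule represent)+) (simp_all add: c)
    ultimately show False using t(2) c(4) by simp
  qed
  let ?B = "A\<lparr>carrier := B\<rparr>"
  have ne: "?H \<noteq> {\<zero>\<^bsub>?B\<^esub>}" using wbH wb by auto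
  obtain p where pH: "p \<in> ?H" and pr: "projection ?B p" and p0: "p \<noteq> \<zero>\<^bsub>?B\<^esub>"
    using SP[unfolded property_SP_def, THEN spec, THEN mp,
        OF conjI[OF hereditary_annihilator[OF B z zs] ne]] by blast
  have p: "p \<in> carrier A" "p\<^sup>\<star> = p" "p \<otimes> p = p" "z \<otimes> p = \<zero>"
    using pr pH BD(1) by (auto simp: projection_def)
  have p1: "\<parallel>p\<parallel> \<le> 1" using p(1-3) by (rule norm_projection_le)
  let ?M = "\<parallel>b\<parallel>"
  let ?D = "of_real ?M \<odot> p \<ominus> p \<otimes> b \<otimes> p"
  have "?D = of_real ?M \<odot> (p \<ominus> p \<otimes> p) \<oplus> p\<^sup>\<star> \<otimes> (of_real ?M \<odot> \<one> \<ominus> b) \<otimes> p"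
    by (rule algebraic_identity[where xs="[b]" and ys="[p]"], (rule represent)+) (simp_all add: bc p(1,2))
  then have D: "herm_square ?D"
    using herm_square_conj[OF herm_square_scalar_minus[OF bc b(2) order_refl] p(1)] p bc by simp
  have C: "herm_square (p \<otimes> c \<otimes> p)" using herm_square_conj[OF c(4) p(1)] p(2) by simp
  \<comment> \<open>Here \<open>c = z + k\<close> and \<open>z p = 0\<close>, so the compression of
    \<open>c\<close> equals that of \<open>b - t\<close> and \<open>b\<close> cancels.\<close>
  have "?D \<oplus> p \<otimes> c \<otimes> p = of_real (?M - t) \<odot> p \<oplus> p \<otimes> (z \<otimes> p) \<oplus> of_real t \<odot> (p \<ominus> p \<otimes> p)"
    unfolding z_def k_def
    by (rule algebraic_identity[where xs="[b,c,p]" and ys="[]"], (rule represent)+) (simp_all add: bc c p(1))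
  also have "\<dots> = of_real (?M - t) \<odot> p" using p by simp
  finally have "\<parallel>?D\<parallel> \<le> \<parallel>of_real (?M - t) \<odot> p\<parallel>" using herm_square_norm_mono[OF D C] by simp
  also have "\<dots> \<le> \<bar>?M - t\<bar>" using norm_scale[OF p(1), of "of_real (?M - t)"] p1
    by (simp add: mult_left_le del: of_real_diff)
  finally show ?thesis using that p p0 by simp
qed

text \<open>Error budget: \<open>e = g h\<^sup>2 g\<close> has norm at least 7/8 and
  \<open>b\<close> is within 1/8 of it, so \<open>b\<close> has norm at least 6/8, and the cut at
  1/2 leaves a margin for replacing \<open>b\<close> by \<open>e\<close> again.\<close>

lemma projection_in_hereditary:
  assumes H: "hereditary_subalgebra A H" and h: "h \<in> H" "h\<^sup>\<star> = h"
    and B: "cstar_subalgebra A B" and SP: "property_SP (A\<lparr>carrier := B\<rparr>)"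
    and g: "g \<in> B" "g\<^sup>\<star> = g" "\<parallel>g\<parallel> \<le> 1"
    and near: "near A (1/8) (g \<otimes> (h \<otimes> h)) B" and large: "\<parallel>g \<otimes> (h \<otimes> h) \<otimes> g\<parallel> \<ge> 7/8"
  obtains p where "p \<in> H" "projection A p" "p \<noteq> \<zero>"
proof -
  note BD = cstar_subalgebraD[OF B]
  have hc: "h \<in> carrier A"
    using H h by (auto simp: hereditary_subalgebra_def dest: cstar_subalgebraD(1))
  have gc: "g \<in> carrier A" using g BD(1) by auto
  define e where "e = g \<otimes> (h \<otimes> h) \<otimes> g"
  have e: "e \<in> carrier A" "e\<^sup>\<star> = e" using gc g hc h by (simp_all add: e_def star_mult mult_assoc)
  have "e = (h \<otimes> g)\<^sup>\<star> \<otimes> (h \<otimes> g)" using gc g hc h by (simp add: e_def star_mult mult_assoc)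
  then have ep: "herm_square e" using herm_square_star_mult_self[of "h \<otimes> g"] hc gc by simp
  obtain b1 where b1: "b1 \<in> B" "\<parallel>g \<otimes> (h \<otimes> h) \<ominus> b1\<parallel> < 1/8" using near by (auto simp: near_def)
  have b1c: "b1 \<in> carrier A" using b1 BD(1) by auto
  \<comment> \<open>The approximation is known for \<open>g h\<^sup>2\<close> only; multiplying by
    \<open>g\<close> on the right stays in \<open>B\<close> and, as \<open>g\<close> has norm at
    most 1, does not increase the error.\<close>
  have "e \<ominus> b1 \<otimes> g = (g \<otimes> (h \<otimes> h) \<ominus> b1) \<otimes> g" unfolding e_def
    by (rule algebraic_identity[where xs="[g,h,b1]" and ys="[]"], (rule represent)+) (simp_all add: gc hc b1c)
  also have "\<parallel>\<dots>\<parallel> \<le> \<parallel>g \<otimes> (h \<otimes> h) \<ominus> b1\<parallel> * \<parallel>g\<parallel>" using norm_mult gc hc b1c by simp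
  also have "\<dots> \<le> 1/8 * 1" using b1 g gc hc b1c norm_nonneg by (intro mult_mono) simp_all
  finally have "\<parallel>e \<ominus> b1 \<otimes> g\<parallel> \<le> 1/8" by simp
  then obtain b where b: "b \<in> B" "b\<^sup>\<star> = b" "\<parallel>e \<ominus> b\<parallel> \<le> 1/8"
    using hermitian_approximation[OF B BD(4)[OF b1(1) g(1)] e] by (metis order_trans)
  have bc: "b \<in> carrier A" using b BD(1) by auto
  have eb: "(e \<ominus> b)\<^sup>\<star> = e \<ominus> b"
    by (rule algebraic_identity[where xs="[]" and ys="[e,b]"], (rule represent)+) (simp_all add: e b bc)
  \<comment> \<open>If \<open>b \<le> 1/2\<close>, then
    \<open>e = b + (e - b) \<le> 1/2 + 1/8 = 5/8\<close>, against the lower bound 7/8.\<close>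
  have "\<not> herm_square (of_real (1/2) \<odot> \<one> \<ominus> b)"
  proof
    assume *: "herm_square (of_real (1/2) \<odot> \<one> \<ominus> b)"
    have "herm_square (of_real (1/8) \<odot> \<one> \<ominus> (e \<ominus> b))"
      using herm_square_scalar_minus[OF _ eb b(3)] e bc by simp
    from herm_square_add[OF * this]
    have "herm_square (of_real (5/8) \<odot> \<one> \<ominus> e)"
    proof (rule back_subst[where P=herm_square])
      show "of_real (1/2) \<odot> \<one> \<ominus> b \<oplus> (of_real (1/8) \<odot> \<one> \<ominus> (e \<ominus> b)) = of_real (5/8) \<odot> \<one> \<ominus> e"
        by (rule algebraic_identity[where xs="[e,b]" and ys="[]"], (rule represent)+) (simp_all add: e bc)
    qed
    then have "\<parallel>e\<parallel> \<le> 5/8" by (intro herm_square_norm_le[OF ep]) simp_all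
    then show False using large by (simp add: e_def)
  qed
  then obtain p where p: "p \<in> carrier A" "p\<^sup>\<star> = p" "p \<otimes> p = p" "p \<noteq> \<zero>"
    "\<parallel>of_real \<parallel>b\<parallel> \<odot> p \<ominus> p \<otimes> b \<otimes> p\<parallel> \<le> \<bar>\<parallel>b\<parallel> - 1/2\<bar>"
    using spectral_corner_projection[OF B SP b(1,2), of "1/2"] by auto
  have M: "\<parallel>b\<parallel> \<ge> 6/8"
    using norm_le_norm_minus[OF e(1) bc] b(3) large by (simp add: e_def)
  have p1: "\<parallel>p\<parallel> \<le> 1" using p(1-3) by (rule norm_projection_le)
  have "p \<otimes> b \<otimes> p \<ominus> p \<otimes> e \<otimes> p = p \<otimes> (b \<ominus> e) \<otimes> p"
    by (rule algebraic_identity[where xs="[e,b,p]" and ys="[]"], (rule represent)+) (simp_all add: e bc p(1))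
  also have "\<parallel>\<dots>\<parallel> \<le> (\<parallel>p\<parallel> * \<parallel>b \<ominus> e\<parallel>) * \<parallel>p\<parallel>"
    using norm_mult[of "p \<otimes> (b \<ominus> e)" p] norm_mult[of p "b \<ominus> e"] norm_nonneg[OF p(1)] p(1) bc e(1)
    by (smt (verit) closed mult_right_mono)
  also have "\<dots> \<le> (1 * (1/8)) * 1"
    using p1 b(3) norm_nonneg p(1) bc e(1) norm_minus_commute[OF bc e(1)] by (intro mult_mono) simp_all
  finally have "\<parallel>p \<otimes> b \<otimes> p \<ominus> p \<otimes> e \<otimes> p\<parallel> \<le> 1/8" by simp
  \<comment> \<open>The distance is at most \<open>(\<parallel>b\<parallel> - 1/2) + 1/8\<close>;
    the absolute value opens because the norm of \<open>b\<close> exceeds 1/2.\<close>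
  then have "\<parallel>of_real \<parallel>b\<parallel> \<odot> p \<ominus> p \<otimes> e \<otimes> p\<parallel> < \<parallel>b\<parallel>"
    using norm_triangle_minus[of "of_real \<parallel>b\<parallel> \<odot> p" "p \<otimes> b \<otimes> p" "p \<otimes> e \<otimes> p"] p(1,5) bc e(1) M by simp
  then obtain k where k: "k \<in> carrier A" "k\<^sup>\<star> = k"
    "(h \<otimes> k \<otimes> h) \<otimes> (h \<otimes> k \<otimes> h) = h \<otimes> k \<otimes> h" "h \<otimes> k \<otimes> h \<noteq> \<zero>"
    unfolding e_def using idempotent_from_corner[OF hc h(2) gc g(2) p(1-4)] by metis
  have "(h \<otimes> k \<otimes> h)\<^sup>\<star> = h \<otimes> k \<otimes> h" using hc h k(1,2) by (simp add: star_mult mult_assoc)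
  then have "projection A (h \<otimes> k \<otimes> h)" using k hc by (simp add: projection_def)
  then show ?thesis using that idempotent_in_hereditary[OF H h k(1-3)] k(4) by blast
qed

end

section \<open>From the approximation property to property SP\<close>

theorem theorem3p5:
  fixes \<Omega> :: "'a cstar_struct set" and A :: "'a cstar_struct"
  assumes "\<forall>B\<in>\<Omega>. cstar_algebra B \<and> property_SP B"
    and "cstar_algebra A" and "simple A" and "unital A"
    and "A \<in> gTA \<Omega>"
  shows "property_SP A"
proof -
  interpret unital_cstar_algebra A
    using assms(2,4) by (simp add: unital_cstar_algebra_def unital_cstar_algebra_axioms_def)
  have "\<exists>p\<in>H. projection A p \<and> p \<noteq> \<zero>\<^bsub>A\<^esub>"
    if H: "hereditary_subalgebra A H" and ne: "H \<noteq> {\<zero>\<^bsub>A\<^esub>}" for H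
  proof -
    have sub: "cstar_subalgebra A H" using H by (simp add: hereditary_subalgebra_def)
    obtain h where h: "h \<in> H" "h\<^sup>\<star>\<^bsub>A\<^esub> = h" "\<parallel>h\<parallel>\<^bsub>A\<^esub> = 1"
      using unit_norm_hermitian_in_subalgebra[OF sub ne] by metis
    have hc: "h \<in> carrier A" using h cstar_subalgebraD(1)[OF sub] by auto
    let ?a = "h \<otimes>\<^bsub>A\<^esub> h"
    have a1: "\<parallel>?a\<parallel>\<^bsub>A\<^esub> = 1" using norm_square[OF hc h(2)] h(3) by simp
    have a: "positive A ?a" "?a \<noteq> \<zero>\<^bsub>A\<^esub>" "?a \<in> carrier A"
      using positive_if_herm_square[OF herm_squareI[OF hc h(2)]] a1 norm_zero hc by auto
    \<comment> \<open>Both \<open>F = {h\<^sup>2}\<close> and \<open>a = h\<^sup>2\<close>: the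
      former puts \<open>g h\<^sup>2\<close> near \<open>B\<close>, the latter gives
      \<open>g h\<^sup>2 g\<close> norm at least \<open>1 - 1/8 = 7/8\<close>.\<close>
    have "finite {?a} \<and> {?a} \<subseteq> carrier A \<and> positive A ?a \<and> positive A ?a \<and> ?a \<noteq> \<zero>\<^bsub>A\<^esub>"
      using a by simp
    from assms(5)[unfolded gTA_def mem_Collect_eq, THEN conjunct2, THEN conjunct2, rule_format,
        OF _ this, of "1/8"]
    obtain B g where B: "cstar_subalgebra A B" "A\<lparr>carrier := B\<rparr> \<in> \<Omega>"
      and g: "positive (A\<lparr>carrier := B\<rparr>) g" "\<parallel>g\<parallel>\<^bsub>A\<^esub> \<le> 1"
      and near: "near A (1/8) (g \<otimes>\<^bsub>A\<^esub> ?a) B" and large: "\<parallel>g \<otimes>\<^bsub>A\<^esub> ?a \<otimes>\<^bsub>A\<^esub> g\<parallel>\<^bsub>A\<^esub> \<ge> 7/8"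
      using a1 by auto
    have "g \<in> B" "g\<^sup>\<star>\<^bsub>A\<^esub> = g" using g(1) by (auto simp: positive_def)
    moreover have "property_SP (A\<lparr>carrier := B\<rparr>)" using assms(1) B(2) by blast
    ultimately show ?thesis
      using projection_in_hereditary[OF H h(1,2) B(1)] g(2) near large by metis
  qed
  then show ?thesis by (simp add: property_SP_def)
qed

end
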